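(* Let $d,\ell\in\mathbb{N}^+$, let $\mathscr{B}$ be a Banach function space with the algebra property, let $\Delta,\tilde\Delta_1,\dots,\tilde\Delta_\ell$ be approximation functions, let $F_j\in\mathscr{B}_{\tilde\Delta_j}$ for $1\le j\le \ell$, and let $\rho_1,\dots,\rho_\ell\in\mathbb{T}^d$ satisfy the finite-dimensional joint nonresonant condition with $\Delta$ (discrete version for the discrete average, continuous version for the continuous average). Assume that for some integer $m\ge 2$ $$\sum_{k^1,\dots,k^\ell\in\mathbb{Z}^d\setminus\{0\}}\frac{\Delta^m\big(\sum_{j=1}^\ell\|k^j\|\big)}{\prod_{j=1}^\ell\tilde\Delta_j(\|k^j\|)}<+\infty .$$ Then $$\Big\|\mathrm{DMW}_N^\ell(\mathcal F)(\theta)-\prod_{j=1}^\ell\Big(\int_{\mathbb{T}^d}F_j(\hat\theta)\,d\hat\theta\Big)\Big\|_{\mathscr B}=\mathcal{O}(N^{-m})$$ and $$\Big\|\mathrm{CMW}_T^\ell(\mathcal F)(\theta)-\prod_{j=1}^\ell\Big(\int_{\mathbb{T}^d}F_j(\hat\theta)\,d\hat\theta\Big)\Big\|_{\mathscr B}=\mathcal{O}(T^{-m})$$ whenever $N\in\mathbb N^+$ and $T>0$ are sufficiently large.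
   Context: Weight: $w(x)=\exp(-x^{-1}(1-x)^{-1})\big(\int_0^1\exp(-t^{-1}(1-t)^{-1})dt\big)^{-1}$ for $x\in(0,1)$ and $w(x)=0$ otherwise. Torus and rotations: $\mathbb{T}^d=[0,1]^d$ with coordinates mod 1; for $\rho\in\mathbb{T}^d$ and $s\ge0$, $\mathscr{T}_\rho^s(\theta)=\theta+s\rho \bmod 1$ in each coordinate. Averages: with $A_N=\sum_{s=0}^{N-1}w(s/N)$, $$\mathrm{DMW}_N^\ell(\mathcal F)(\theta)=\frac1{A_N}\sum_{n=0}^{N-1}w(n/N)F_1(\mathscr{T}_{\rho_1}^n(\theta))\cdots F_\ell(\mathscr{T}_{\rho_\ell}^n(\theta)),$$ $$\mathrm{CMW}_T^\ell(\mathcal F)(\theta)=\frac1T\int_0^T w(s/T)F_1(\mathscr{T}_{\rho_1}^s(\theta))\cdots F_\ell(\mathscr{T}_{\rho_\ell}^s(\theta))\,ds .$$ Approximation function: a continuous, strictly increasing $\Delta:[1,+\infty)\to[1,+\infty)$ with $\Delta(+\infty)=+\infty$. $\|k\|=|k_1|+\cdots+|k_d|$ is the $1$-norm of an integer vector. Finite-dimensional joint nonresonant condition with $\Delta$: there is $\alpha>0$ such that the joint rotation $\tilde\rho=(\rho_1,\dots,\rho_\ell)\in\mathbb{T}^{d\ell}$ satisfies, in the discrete case, $|k\cdot\tilde\rho-n|\ge\alpha/\Delta(\|k\|)$ for all $0\ne k\in\mathbb{Z}^{d\ell}$ and all $n\in\mathbb{Z}$; in the continuous case, $|k\cdot\tilde\rho|\ge\alpha/\Delta(\|k\|)$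 for all $0\ne k\in\mathbb{Z}^{d\ell}$. $(\mathscr B,\|\cdot\|_{\mathscr B})$ is a Banach (function) space with the algebra property (products of elements are in $\mathscr B$, with bounded multiplication). $\mathscr{B}_{\tilde\Delta}$ is the set of $f:\mathbb{T}^d\to\mathscr B$ with $f(\theta)=\sum_{k\in\mathbb{Z}^d}\hat f_k e^{2\pi i k\cdot\theta}$ (equality in the norm of $\mathscr B$), $\hat f_k=\int_{\mathbb{T}^d}f(\hat\theta)e^{-2\pi i k\cdot\hat\theta}d\hat\theta$, and $\sup_{0\ne k\in\mathbb{Z}^d}\tilde\Delta(\|k\|)\|\hat f_k\|_{\mathscr B}<+\infty$. Products of such functions are taken through multiplication in $\mathscr B$ (equivalently, by multiplying Fourier series). $\mathcal{O}(\cdot)$ means bounded by a constant, independent of $N$ (resp. $T$), times the argument for all sufficiently large $N$ (resp. $T$). *)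

theory Defs
  imports "HOL-Analysis.Analysis"
begin

text \<open>
  A complex Banach space with a bounded multiplication. The library classes only know real
  scalars, so the complex structure is added here. No unit is required (many function algebras
  have none) and the multiplicative constant need not be 1, in contrast to the library class
  of real normed algebras; commutativity is not needed either.
\<close>

class complex_banach_algebra = banach + real_algebra +
  fixes scaleC :: "complex \<Rightarrow> 'a \<Rightarrow> 'a"  (infixr "*\<^sub>C" 75)
  assumes scaleC_add_right: "c *\<^sub>C (x + y) = c *\<^sub>C x + c *\<^sub>C y"
    and scaleC_add_left: "(b + c) *\<^sub>C x = b *\<^sub>C x + c *\<^sub>C x"
    and scaleC_scaleC: "b *\<^sub>C (c *\<^sub>C x) = (b * c) *\<^sub>C x"
    and scaleC_of_real: "complex_of_real r *\<^sub>C x = r *\<^sub>R x"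
    and norm_scaleC: "norm (c *\<^sub>C x) = cmod c * norm x"
    and scaleC_mult_left: "(c *\<^sub>C x) * y = c *\<^sub>C (x * y)"
    and scaleC_mult_right: "x * (c *\<^sub>C y) = c *\<^sub>C (x * y)"
    and norm_mult_bounded: "\<exists>K. \<forall>x y. norm (x * y) \<le> K * norm x * norm y"

instantiation complex :: complex_banach_algebra
begin

definition scaleC_complex :: "complex \<Rightarrow> complex \<Rightarrow> complex"
  where "scaleC_complex c x = c * x"

instance
proof
  show "\<exists>K. \<forall>x y :: complex. norm (x * y) \<le> K * norm x * norm y"
    by (rule exI[of _ 1]) (simp add: norm_mult)
qed (simp_all add: scaleC_complex_def algebra_simps norm_mult scaleR_conv_of_real)

end

text \<open>The ordered product \<open>f 1 * \<dots> * f l\<close> for \<open>l \<ge> 1\<close>; as there is no unit,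
  the value at \<open>l = 0\<close> is a dummy.\<close>

fun ordered_prod :: "(nat \<Rightarrow> 'b :: complex_banach_algebra) \<Rightarrow> nat \<Rightarrow> 'b" where
  "ordered_prod f 0 = 0"
| "ordered_prod f (Suc 0) = f 1"
| "ordered_prod f (Suc (Suc n)) = ordered_prod f (Suc n) * f (Suc (Suc n))"

definition bump :: "real \<Rightarrow> real"
  where "bump x = exp (- (inverse x * inverse (1 - x)))"

definition weight :: "real \<Rightarrow> real"
  where "weight x = (if 0 < x \<and> x < 1 then bump x / integral {0..1} bump else 0)"

text \<open>The cube is the set of representatives of the torus. A function on the torus is
  represented by a function on the cube that agrees on opposite faces; the functions below
  have this property because they are the sum of their Fourier series on the closed cube.\<close>

definition torus :: "(real ^ 'd) set"
  where "torus = {x. \<forall>i. 0 \<le> x $ i \<and> x $ i \<le> 1}"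

definition rot :: "real ^ 'd \<Rightarrow> real \<Rightarrow> real ^ 'd \<Rightarrow> real ^ 'd"
  where "rot \<rho> s \<theta> = (\<chi> i. frac (\<theta> $ i + s * \<rho> $ i))"

definition l1norm :: "int ^ 'd \<Rightarrow> real"
  where "l1norm k = (\<Sum>i\<in>UNIV. \<bar>real_of_int (k $ i)\<bar>)"

definition idot :: "int ^ 'd \<Rightarrow> real ^ 'd \<Rightarrow> real"
  where "idot k x = (\<Sum>i\<in>UNIV. real_of_int (k $ i) * x $ i)"

definition approximation_function :: "(real \<Rightarrow> real) \<Rightarrow> bool"
  where "approximation_function \<Delta> \<longleftrightarrow>
    continuous_on {1..} \<Delta> \<and> strict_mono_on {1..} \<Delta> \<and> (\<forall>x\<ge>1. 1 \<le> \<Delta> x) \<and>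
    filterlim \<Delta> at_top at_top"

text \<open>Vectors in \<open>\<int>\<^sup>d\<^sup>l\<close> are given by their blocks \<open>k 1, \<dots>, k l\<close>; values of \<open>k\<close> outside
  \<open>{1..l}\<close> are irrelevant.\<close>

definition joint_nonresonant_discrete ::
    "(real \<Rightarrow> real) \<Rightarrow> nat \<Rightarrow> (nat \<Rightarrow> real ^ 'd) \<Rightarrow> bool"
  where "joint_nonresonant_discrete \<Delta> l \<rho> \<longleftrightarrow>
    (\<exists>\<alpha>>0. \<forall>k :: nat \<Rightarrow> int ^ 'd. \<forall>n :: int. (\<exists>j\<in>{1..l}. k j \<noteq> 0) \<longrightarrow>
      \<bar>(\<Sum>j=1..l. idot (k j) (\<rho> j)) - real_of_int n\<bar> \<ge> \<alpha> / \<Delta> (\<Sum>j=1..l. l1norm (k j)))"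

definition joint_nonresonant_continuous ::
    "(real \<Rightarrow> real) \<Rightarrow> nat \<Rightarrow> (nat \<Rightarrow> real ^ 'd) \<Rightarrow> bool"
  where "joint_nonresonant_continuous \<Delta> l \<rho> \<longleftrightarrow>
    (\<exists>\<alpha>>0. \<forall>k :: nat \<Rightarrow> int ^ 'd. (\<exists>j\<in>{1..l}. k j \<noteq> 0) \<longrightarrow>
      \<bar>\<Sum>j=1..l. idot (k j) (\<rho> j)\<bar> \<ge> \<alpha> / \<Delta> (\<Sum>j=1..l. l1norm (k j)))"

text \<open>Integrals of vector-valued functions are Henstock-Kurzweil integrals: the library's Bochner
  integral would force the target space to be separable.\<close>

definition fourier_coeff :: "(real ^ 'd \<Rightarrow> 'b :: complex_banach_algebra) \<Rightarrow> int ^ 'd \<Rightarrow> 'b"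
  where "fourier_coeff f k = integral torus (\<lambda>\<theta>. cis (- (2 * pi * idot k \<theta>)) *\<^sub>C f \<theta>)"

definition fourier_space ::
    "(real \<Rightarrow> real) \<Rightarrow> (real ^ 'd \<Rightarrow> 'b :: complex_banach_algebra) set"
  where "fourier_space \<Delta> = {f.
    (\<forall>k. (\<lambda>\<theta>. cis (- (2 * pi * idot k \<theta>)) *\<^sub>C f \<theta>) integrable_on torus) \<and>
    (\<forall>\<theta>\<in>torus. ((\<lambda>k. cis (2 * pi * idot k \<theta>) *\<^sub>C fourier_coeff f k) has_sum f \<theta>) UNIV) \<and>
    bdd_above ((\<lambda>k. \<Delta> (l1norm k) * norm (fourier_coeff f k)) ` (UNIV - {0}))}"

definition DMW ::
    "nat \<Rightarrow> (nat \<Rightarrow> real ^ 'd) \<Rightarrow> (nat \<Rightarrow> real ^ 'd \<Rightarrow> 'b :: complex_banach_algebra) \<Rightarrow>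
      nat \<Rightarrow> real ^ 'd \<Rightarrow> 'b"
  where "DMW l \<rho> F N \<theta> = (1 / (\<Sum>s<N. weight (real s / real N))) *\<^sub>R
    (\<Sum>n<N. weight (real n / real N) *\<^sub>R ordered_prod (\<lambda>j. F j (rot (\<rho> j) (real n) \<theta>)) l)"

definition CMW ::
    "nat \<Rightarrow> (nat \<Rightarrow> real ^ 'd) \<Rightarrow> (nat \<Rightarrow> real ^ 'd \<Rightarrow> 'b :: complex_banach_algebra) \<Rightarrow>
      real \<Rightarrow> real ^ 'd \<Rightarrow> 'b"
  where "CMW l \<rho> F T \<theta> = (1 / T) *\<^sub>R
    integral {0..T} (\<lambda>s. weight (s / T) *\<^sub>R ordered_prod (\<lambda>j. F j (rot (\<rho> j) s \<theta>)) l)"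

end

theory Submission
  imports Defs
begin

text \<open>Along an orbit, the product of the \<open>F j\<close> is a superposition of pure exponentials: multiplying the
  Fourier series gives, over all multi-indices \<open>k = (k 1, \<dots>, k l)\<close>, terms
  \<open>cis (2\<pi> s \<phi> k) *\<^sub>C H k\<close> with frequency \<open>\<phi> k = \<Sum>j. k j \<sqdot> \<rho> j\<close> and with the norm of \<open>H k\<close> equal to
  that of the product of the Fourier coefficients (\<open>product_along_orbit_has_sum\<close>). The averages act
  on each term separately. The term \<open>k = 0\<close> is constant, so every normalized average returns it
  unchanged, and it is the product of the space averages. All other terms oscillate, and the
  theorem says that the smooth weight makes them small.

  The weight and all its derivatives vanish outside the open unit interval, hence summation by
  parts (\<open>summation_by_parts_bound\<close>), respectively integration by parts
  (\<open>integration_by_parts_bound\<close>), can be done \<open>m\<close> times without boundary terms. Each step gains a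
  factor \<open>1/N\<close> from the derivative of \<open>w(n/N)\<close> and costs a factor \<open>1/\<delta>\<close>, where \<open>\<delta>\<close> is the distance
  of \<open>\<phi> k\<close> from the integers (from \<open>0\<close> in the continuous case). Thus the average of the term \<open>k\<close> is
  of size \<open>(\<delta> N)\<close> to the power \<open>-m\<close>, and nonresonance gives \<open>\<delta> \<ge> \<alpha> / \<Delta>(\<parallel>k\<parallel>)\<close>. The loss
  \<open>\<Delta>(\<parallel>k\<parallel>) ^ m\<close> is what the summability hypothesis pays for.

  That hypothesis only speaks of multi-indices all of whose blocks are nonzero, while the expansion
  has all multi-indices. Replacing every zero block by a fixed nonzero vector reduces the second
  sum to the first: this map is finite-to-one, it does not decrease \<open>\<Delta>(\<parallel>k\<parallel>)\<close> for nonzero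
  \<open>k\<close>, and it changes the bound for a coefficient by a constant factor
  (\<open>summable_weighted_coefficients\<close>).\<close>

section \<open>Smoothness and mass of the weight\<close>

text \<open>The derivatives of \<open>exp (-1/x)\<close> are polynomials in \<open>1/x\<close> times the same exponential. Admitting
  an arbitrary polynomial makes the class closed under differentiation.\<close>

definition flat :: "real poly \<Rightarrow> real \<Rightarrow> real"
  where "flat p x = (if x > 0 then poly p (inverse x) * exp (- inverse x) else 0)"

lemma poly_times_exp_neg_tendsto_0:
  "((\<lambda>u::real. poly p u * exp (- u)) \<longlongrightarrow> 0) at_top"
proof -
  have "((\<lambda>u::real. \<Sum>i\<le>degree p. coeff p i * (u ^ i / exp u)) \<longlongrightarrow> 
      (\<Sum>i\<le>degree p. coeff p i * 0)) at_top"
    by (intro tendsto_sum tendsto_mult tendsto_const tendsto_power_div_exp_0)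
  then show ?thesis
    by (simp add: poly_altdef exp_minus field_simps sum_divide_distrib)
qed

text \<open>Away from 0 this is the chain rule. At 0 the difference quotient from the right is, in the
  variable \<open>u = 1/x\<close>, a polynomial times \<open>exp (-u)\<close>, and tends to 0 as \<open>u\<close> tends to infinity.\<close>

lemma flat_has_derivative:
  "(flat p has_real_derivative flat (monom 1 2 * (p - pderiv p)) x) (at x)"
proof (cases "x = 0")
  case True
  have "((\<lambda>h. flat p h / h) \<longlongrightarrow> 0) (at_left 0)"
    by (rule tendsto_eventually) (auto simp: flat_def eventually_at_filter)
  moreover have "((\<lambda>h. flat p h / h) \<longlongrightarrow> 0) (at_right 0)"
  proof -
    have "((\<lambda>u. poly (monom 1 1 * p) u * exp (- u)) \<longlongrightarrow> 0) at_top"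
      by (rule poly_times_exp_neg_tendsto_0)
    then have "((\<lambda>u. flat p (inverse u) / inverse u) \<longlongrightarrow> 0) at_top"
    proof (rule Lim_transform_eventually)
      show "\<forall>\<^sub>F u in at_top. poly (monom 1 1 * p) u * exp (- u) =
          flat p (inverse u) / inverse u"
        using eventually_gt_at_top[of 0]
        by eventually_elim (simp add: flat_def poly_monom divide_inverse mult_ac)
    qed
    then show ?thesis
      by (subst filterlim_at_right_to_top)
  qed
  ultimately have "((\<lambda>h. flat p h / h) \<longlongrightarrow> 0) (at 0)"
    by (rule filterlim_split_at)
  moreover have "flat p 0 = 0" "flat (monom 1 2 * (p - pderiv p)) 0 = 0"
    by (simp_all add: flat_def)
  ultimately show ?thesis
    unfolding True DERIV_def by simp
next
  case False
  then consider "x > 0" | "x < 0" by linarith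
  then show ?thesis
  proof cases
    case 1
    have "((\<lambda>x. poly p (inverse x) * exp (- inverse x)) has_real_derivative
        flat (monom 1 2 * (p - pderiv p)) x) (at x)"
      using 1 by (auto intro!: derivative_eq_intros
        simp: flat_def poly_monom algebra_simps power2_eq_square)
    moreover have "\<forall>\<^sub>F y in nhds x. flat p y = poly p (inverse y) * exp (- inverse y)"
      using eventually_nhds_in_open[of "{0<..}" x] 1
      by (auto elim!: eventually_mono simp: flat_def)
    ultimately show ?thesis
      by (rule DERIV_cong_ev[OF refl _ refl, THEN iffD2, rotated])
  next
    case 2
    have "\<forall>\<^sub>F y in nhds x. flat p y = 0"
      using eventually_nhds_in_open[of "{..<0}" x] 2
      by (auto elim!: eventually_mono simp: flat_def)
    moreover have "((\<lambda>x. 0) has_real_derivative flat (monom 1 2 * (p - pderiv p)) x) (at x)"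
      using 2 by (simp add: flat_def)
    ultimately show ?thesis
      by (rule DERIV_cong_ev[OF refl _ refl, THEN iffD2])
  qed
qed

text \<open>On \<open>(0,1)\<close> the exponent \<open>1/(x(1-x))\<close> equals \<open>1/x + 1/(1-x)\<close>, so the bump is a product of one
  function that is flat at 0 and one that is flat at 1. Finite sums of such products contain the
  weight and are closed under differentiation by the Leibniz rule, which gives
  smoothness on the whole line without a formula for the higher derivatives.\<close>

inductive flat_at_ends :: "(real \<Rightarrow> real) \<Rightarrow> bool" where
  product: "flat_at_ends (\<lambda>x. flat p x * flat q (1 - x))"
| sum: "flat_at_ends f \<Longrightarrow> flat_at_ends g \<Longrightarrow> flat_at_ends (\<lambda>x. f x + g x)"

lemma flat_at_ends_derivative:
  assumes "flat_at_ends f"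
  shows "\<exists>f'. flat_at_ends f' \<and> (\<forall>x. (f has_real_derivative f' x) (at x))"
  using assms
proof induction
  case (product p q)
  define p' where "p' = monom 1 2 * (p - pderiv p)"
  define q' where "q' = monom 1 2 * (q - pderiv q)"
  have "((\<lambda>x. flat p x * flat q (1 - x)) has_real_derivative
      flat p' x * flat q (1 - x) + flat p x * flat (- q') (1 - x)) (at x)" for x
  proof -
    have 1: "(flat p has_real_derivative flat p' x) (at x)"
      unfolding p'_def by (rule flat_has_derivative)
    have 2: "((\<lambda>x. flat q (1 - x)) has_real_derivative flat q' (1 - x) * (- 1)) (at x)"
      unfolding q'_def
      by (rule DERIV_chain2[OF flat_has_derivative]) (auto intro!: derivative_eq_intros)
    have "flat (- q') (1 - x) = - flat q' (1 - x)"
      by (simp add: flat_def)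
    then show ?thesis
      using DERIV_mult[OF 1 2] by (simp add: mult.commute)
  qed
  then show ?case
    using flat_at_ends.sum[OF flat_at_ends.product flat_at_ends.product, of p' q p "- q'"]
    by (intro exI conjI allI)
next
  case (sum f g)
  then obtain f' g' where "flat_at_ends f'" "flat_at_ends g'"
    "\<And>x. (f has_real_derivative f' x) (at x)" "\<And>x. (g has_real_derivative g' x) (at x)"
    by auto
  then show ?case
    by (intro exI[of _ "\<lambda>x. f' x + g' x"] conjI allI flat_at_ends.sum DERIV_add)
qed

lemma flat_at_ends_zero:
  assumes "flat_at_ends f" "x \<le> 0 \<or> x \<ge> 1"
  shows "f x = 0"
  using assms by induction (auto simp: flat_def)

lemma bump_eq_flat: "bump x = flat 1 x * flat 1 (1 - x)" if "0 < x" "x < 1"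
proof -
  have "inverse x * inverse (1 - x) = inverse x + inverse (1 - x)"
    using that by (simp add: field_simps)
  then show ?thesis
    using that by (simp add: bump_def flat_def flip: exp_add)
qed

lemma continuous_flat: "continuous_on A (flat p)"
  by (rule DERIV_continuous_on[OF has_field_derivative_at_within[OF flat_has_derivative]])

text \<open>At the two endpoints the literal value of the bump is 1, because \<open>inverse 0 = 0\<close>, and not the
  limit 0. A finite set does not affect the integral.\<close>

lemma bump_integral:
  "(bump has_integral integral {0..1} (\<lambda>x. flat 1 x * flat 1 (1 - x))) {0..1}"
  "integral {0..1} bump > 0"
proof -
  let ?g = "\<lambda>x. flat 1 x * flat 1 (1 - x)"
  have cont: "continuous_on {0..1} ?g"
    by (intro continuous_intros continuous_on_compose2[OF continuous_flat]) auto
  show hi: "(bump has_integral integral {0..1} ?g) {0..1}"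
    by (rule has_integral_spike_finite[of "{0, 1}" _ _ ?g])
      (use integrable_integral[OF integrable_continuous_real[OF cont]] bump_eq_flat in auto)
  have "integral {0..1} ?g \<ge> 0"
    by (rule integral_nonneg[OF integrable_continuous_real[OF cont]]) (auto simp: flat_def)
  moreover have "integral {0..1} ?g \<noteq> 0"
  proof
    assume "integral {0..1} ?g = 0"
    then have "\<forall>x\<in>{0..1}. ?g x = 0"
      using integral_eq_0_iff[OF cont] by (auto simp: flat_def)
    then have "?g (1/2) = 0" by (rule bspec) auto
    then show False by (simp add: flat_def)
  qed
  ultimately show "integral {0..1} bump > 0"
    using integral_unique[OF hi] by simp
qed

lemma weight_flat_at_ends: "flat_at_ends weight"
proof -
  have eq: "weight = (\<lambda>x. flat [:1 / integral {0..1} bump:] x * flat 1 (1 - x))"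
    by (rule ext) (auto simp: weight_def bump_eq_flat, auto simp: flat_def)
  show ?thesis
    unfolding eq by (rule flat_at_ends.product)
qed

text \<open>The successive derivatives are chosen inside the class \<open>flat_at_ends\<close>, so they all vanish outside \<open>(0,1)\<close> and are bounded
  by compactness.\<close>

lemma weight_derivatives:
  obtains D :: "nat \<Rightarrow> real \<Rightarrow> real" and M :: "nat \<Rightarrow> real" where
    "D 0 = weight"
    "\<And>n x. (D n has_real_derivative D (Suc n) x) (at x)"
    "\<And>n x. x \<le> 0 \<or> x \<ge> 1 \<Longrightarrow> D n x = 0"
    "\<And>n x. \<bar>D n x\<bar> \<le> M n"
proof -
  have "\<exists>D. \<forall>n. (flat_at_ends (D n) \<and> (n = 0 \<longrightarrow> D n = weight)) \<and>
      (\<forall>x. (D n has_real_derivative D (Suc n) x) (at x))"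
    by (rule dependent_nat_choice) (use weight_flat_at_ends flat_at_ends_derivative in auto)
  then obtain D where D: "\<forall>n. flat_at_ends (D n) \<and> (n = 0 \<longrightarrow> D n = weight)"
    "\<forall>n x. (D n has_real_derivative D (Suc n) x) (at x)"
    by blast
  have zero: "D n x = 0" if "x \<le> 0 \<or> x \<ge> 1" for n x
    using D(1) flat_at_ends_zero that by blast
  have "\<exists>M. \<forall>x. \<bar>D n x\<bar> \<le> M" for n
  proof -
    have "continuous_on {0..1} (D n)"
      by (rule DERIV_continuous_on) (use D(2) has_field_derivative_at_within in blast)
    then have "bounded (D n ` {0..1})"
      by (intro compact_imp_bounded compact_continuous_image) auto
    then obtain B where B: "\<And>x. x \<in> {0..1} \<Longrightarrow> \<bar>D n x\<bar> \<le> B"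
      unfolding bounded_iff by (metis imageI real_norm_def)
    have "\<bar>D n x\<bar> \<le> B" for x
    proof (cases "x \<in> {0..1}")
      case False
      then have "D n x = 0" using zero by auto
      moreover have "B \<ge> 0" using B[of 0] by auto
      ultimately show ?thesis by simp
    qed (rule B)
    then show ?thesis by blast
  qed
  then obtain M where "\<And>n x. \<bar>D n x\<bar> \<le> M n" by metis
  then show ?thesis
    using that[of D M] D zero by blast
qed

lemma weight_integral: "(weight has_integral 1) {0..1}"
proof -
  let ?c = "1 / integral {0..1} bump"
  have "((\<lambda>x. bump x * ?c) has_integral integral {0..1} bump * ?c) {0..1}"
    using has_integral_mult_left[OF bump_integral(1), of ?c]
    by (simp add: integral_unique[OF bump_integral(1)])
  then have "((\<lambda>x. bump x * ?c) has_integral 1) {0..1}"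
    using bump_integral(2) by simp
  then show ?thesis
    by (rule has_integral_spike_finite[of "{0, 1}", rotated 2]) (auto simp: weight_def)
qed

lemma weight_nonneg: "weight x \<ge> 0"
  using bump_integral(2) by (simp add: weight_def bump_def)

text \<open>The normalizing sum grows linearly because the weight is bounded below on the middle half of the
  interval, which contains at least a quarter of the sample points once \<open>N \<ge> 4\<close>.\<close>

lemma weight_sum_lower_bound:
  obtains c where "c > 0" "\<And>N. N \<ge> 4 \<Longrightarrow> (\<Sum>n<N. weight (real n / real N)) \<ge> c * real N"
proof -
  define b where "b = exp (- (16 :: real)) / integral {0..1} bump"
  have b: "b > 0" unfolding b_def using bump_integral(2) by simp
  have lower: "weight x \<ge> b" if "1/4 \<le> x" "x \<le> 3/4" for x
  proof -
    have "inverse x * inverse (1 - x) \<le> 4 * 4"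
      using that by (intro mult_mono) (auto simp: field_simps)
    then have "bump x \<ge> exp (- 16)" unfolding bump_def by simp
    then show ?thesis
      using that bump_integral(2) by (simp add: weight_def b_def divide_right_mono)
  qed
  have "(\<Sum>n<N. weight (real n / real N)) \<ge> b / 4 * real N" if N: "N \<ge> 4" for N
  proof -
    define S where "S = {N div 4 + 1..3 * N div 4}"
    have S: "N \<le> 4 * n" "4 * n \<le> 3 * N" if "n \<in> S" for n
      using that unfolding S_def by auto
    have "card S = 3 * N div 4 - N div 4"
      unfolding S_def by simp
    moreover have "4 * (N div 4) \<le> N" "3 * N < 4 * (3 * N div 4) + 4"
      using div_mult_mod_eq[of N 4] div_mult_mod_eq[of "3 * N" 4]
        mod_less_divisor[of 4 "3 * N"] by linarith+
    ultimately have "N \<le> 4 * card S"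
      using N by linarith
    then have "real N \<le> 4 * real (card S)"
      by linarith
    then have "b / 4 * real N \<le> b / 4 * (4 * real (card S))"
      using b by (intro mult_left_mono) auto
    also have "\<dots> = (\<Sum>n\<in>S. b)" by simp
    also have "\<dots> \<le> (\<Sum>n\<in>S. weight (real n / real N))"
    proof (rule sum_mono)
      fix n assume "n \<in> S"
      then have "real N \<le> 4 * real n" "4 * real n \<le> 3 * real N"
        using S[of n] by linarith+
      then show "b \<le> weight (real n / real N)"
        using N by (intro lower) (simp_all add: le_divide_eq divide_le_eq)
    qed
    also have "\<dots> \<le> (\<Sum>n<N. weight (real n / real N))"
    proof (rule sum_mono2)
      show "S \<subseteq> {..<N}"
      proof
        fix n assume "n \<in> S"
        then show "n \<in> {..<N}" using S(2)[of n] N by simp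
      qed
    qed (simp_all add: weight_nonneg)
    finally show ?thesis .
  qed
  then show ?thesis using that[of "b / 4"] b by auto
qed

lemma scaled_weight_integral: "T > 0 \<Longrightarrow> (1 / T) * integral {0..T} (\<lambda>s. weight (s / T)) = 1"
proof -
  assume T: "T > 0"
  have "(\<lambda>x. (1 / (1 / T)) *\<^sub>R x + - ((1 / (1 / T)) *\<^sub>R 0)) ` cbox 0 1 = {0..T}"
    using T by (simp add: image_mult_atLeastAtMost)
  moreover have "(weight has_integral 1) (cbox 0 1)"
    using weight_integral by simp
  ultimately have "((\<lambda>s. weight ((1 / T) *\<^sub>R s + 0)) has_integral
      (1 / (\<bar>1 / T\<bar> ^ DIM(real))) *\<^sub>R 1) {0..T}"
    using has_integral_affinity[of weight 1 0 1 "1 / T" 0] T by fastforce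
  then have "integral {0..T} (\<lambda>s. weight (s / T)) = T"
    using T by (simp add: integral_unique)
  then show ?thesis using T by simp
qed

lemma continuous_on_scaled_weight: "continuous_on A (\<lambda>s. weight (s / T))"
proof -
  obtain D M where "D 0 = weight" "\<And>n x. (D n has_real_derivative D (Suc n) x) (at x)"
    "\<And>n x. x \<le> 0 \<or> x \<ge> 1 \<Longrightarrow> D n x = 0" "\<And>n x. \<bar>D n x\<bar> \<le> M n"
    using weight_derivatives by metis
  then have "continuous_on UNIV weight"
    using DERIV_continuous_on[of UNIV weight "D 1"] by (metis One_nat_def)
  then show ?thesis
    by (rule continuous_on_compose2) (auto intro!: continuous_intros simp: divide_inverse)
qed

section \<open>Cancellation in weighted exponential averages\<close>

text \<open>Multiplication by \<open>1 - z\<close> replaces \<open>D 0\<close> by its backward difference with step \<open>h\<close>, whose \<open>m\<close>-th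
  derivative is at most \<open>h\<close> times the bound for the next derivative, by the mean value theorem. Each
  difference extends the support to the right by \<open>h\<close>; the bound \<open>(M - m) h\<close> on the support leaves
  room for \<open>m\<close> of them, so that no boundary term ever appears.\<close>

lemma summation_by_parts_bound:
  fixes D :: "nat \<Rightarrow> real \<Rightarrow> real" and z :: complex
  assumes "\<And>i x. i < m \<Longrightarrow> (D i has_real_derivative D (Suc i) x) (at x)"
    and "\<And>x. \<bar>D m x\<bar> \<le> B" and "h \<ge> 0" and "cmod z = 1"
    and "\<And>x. x \<le> 0 \<or> x \<ge> (real M - real m) * h \<Longrightarrow> D 0 x = 0"
  shows "cmod (1 - z) ^ m * cmod (\<Sum>n<M. of_real (D 0 (real n * h)) * z ^ n) \<le> real M * (h ^ m * B)"
  using assms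
proof (induction m arbitrary: D B)
  case 0
  have "cmod (\<Sum>n<M. of_real (D 0 (real n * h)) * z ^ n) \<le> (\<Sum>n<M. B)"
    using 0 by (intro sum_norm_le) (simp add: norm_mult norm_power)
  then show ?case by simp
next
  case (Suc m)
  define E where "E i x = D i x - D i (x - h)" for i x
  have "0 \<le> B" using Suc.prems(2)[of 0] by linarith
  have zero: "D 0 x = 0" if "x \<le> 0 \<or> x \<ge> (real M - real m) * h - h" for x
    using Suc.prems(5)[of x] that by (simp add: algebra_simps)
  have parts: "(1 - z) * (\<Sum>n<M. of_real (D 0 (real n * h)) * z ^ n) =
      (\<Sum>n<M. of_real (E 0 (real n * h)) * z ^ n)"
  proof -
    have *: "(1 - z) * (\<Sum>n<K. of_real (D 0 (real n * h)) * z ^ n) =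
      (\<Sum>n<K. of_real (E 0 (real n * h)) * z ^ n) - of_real (D 0 (real K * h - h)) * z ^ K" for K
    proof (induction K)
      case 0
      show ?case using zero[of "- h"] Suc.prems(3) by simp
    next
      case (Suc K)
      then show ?case by (simp add: E_def algebra_simps)
    qed
    have "D 0 (real M * h - h) = 0"
      using Suc.prems(3) by (intro zero) (simp add: algebra_simps)
    then show ?thesis using *[of M] by simp
  qed
  have "cmod (1 - z) ^ m * cmod (\<Sum>n<M. of_real (E 0 (real n * h)) * z ^ n) \<le>
      real M * (h ^ m * (h * B))"
  proof (rule Suc.IH)
    fix i x assume "i < m"
    have "((\<lambda>x. D i (x - h)) has_real_derivative D (Suc i) (x - h) * 1) (at x)"
      using Suc.prems(1)[of i] \<open>i < m\<close>
      by (intro DERIV_chain2[of "D i"] DERIV_cong[OF DERIV_diff[OF DERIV_ident DERIV_const]]) simp_all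
    then show "(E i has_real_derivative E (Suc i) x) (at x)"
      unfolding E_def[abs_def]
      using DERIV_diff[OF Suc.prems(1)[of i x]] \<open>i < m\<close> by simp
  next
    fix x
    show "\<bar>E m x\<bar> \<le> h * B"
    proof (cases "h = 0")
      case False
      then have "x - h < x" using Suc.prems(3) by simp
      then have "\<exists>y>x - h. y < x \<and> D m x - D m (x - h) = (x - (x - h)) * D (Suc m) y"
        by (rule MVT2) (rule Suc.prems(1), simp)
      then obtain y where "D m x - D m (x - h) = (x - (x - h)) * D (Suc m) y"
        by blast
      then have "\<bar>E m x\<bar> = h * \<bar>D (Suc m) y\<bar>"
        using Suc.prems(3) by (simp add: E_def abs_mult)
      then show ?thesis
        using Suc.prems(2)[of y] Suc.prems(3) by (simp add: mult_left_mono)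
    qed (simp add: E_def)
  next
    fix x assume x: "x \<le> 0 \<or> (real M - real m) * h \<le> x"
    then have "D 0 x = 0" "D 0 (x - h) = 0"
      using Suc.prems(3) by (intro zero; linarith)+
    then show "E 0 x = 0" by (simp add: E_def)
  qed (use Suc.prems in auto)
  then show ?case
    unfolding parts[symmetric] by (simp add: norm_mult mult_ac)
qed

text \<open>All boundary terms vanish, so each integration by parts replaces \<open>D 0\<close> by the next derivative and
  divides by the frequency \<open>a\<close>, up to a factor of modulus 1.\<close>

lemma integration_by_parts_bound:
  fixes D :: "nat \<Rightarrow> real \<Rightarrow> real"
  assumes "\<And>i x. (D i has_real_derivative D (Suc i) x) (at x)"
    and "\<And>x. \<bar>D m x\<bar> \<le> B" and "T \<ge> 0"
    and "\<And>i. D i 0 = 0" "\<And>i. D i T = 0"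
  shows "\<bar>a\<bar> ^ m * cmod (integral {0..T} (\<lambda>s. of_real (D 0 s) * cis (a * s))) \<le> T * B"
  using assms
proof (induction m arbitrary: D)
  case 0
  have cont: "continuous_on {0..T} (D 0)"
    by (rule DERIV_continuous_on) (use 0(1) has_field_derivative_at_within in blast)
  have "cmod (integral {0..T} (\<lambda>s. of_real (D 0 s) * cis (a * s))) \<le> B * (T - 0)"
    using 0 by (intro integral_bound continuous_intros cont) (auto simp: norm_mult)
  then show ?case by (simp add: mult.commute)
next
  case (Suc m)
  have cont: "continuous_on {0..T} (D i)" for i
    by (rule DERIV_continuous_on) (use Suc(2) has_field_derivative_at_within in blast)
  define I where "I i = integral {0..T} (\<lambda>s. of_real (D i s) * cis (a * s))" for i
  have int: "((\<lambda>s. of_real (D i s) * cis (a * s)) has_integral I i) {0..T}" for i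
    unfolding I_def
    by (intro integrable_integral integrable_continuous_real continuous_intros cont)
  have "((\<lambda>s. of_real (D 0 s) * cis (a * s)) has_vector_derivative
      of_real (D 1 s) * cis (a * s) + \<i> * of_real a * (of_real (D 0 s) * cis (a * s)))
      (at s within {0..T})" for s
  proof -
    have 1: "((\<lambda>s. complex_of_real (D 0 s)) has_vector_derivative of_real (D 1 s)) (at s within {0..T})"
      using has_field_derivative_at_within[OF Suc.prems(1)[of 0 s]]
      by (simp add: has_vector_derivative_of_real)
    have 2: "((\<lambda>s. cis (a * s)) has_vector_derivative \<i> * of_real a * cis (a * s)) (at s within {0..T})"
      unfolding has_vector_derivative_def
      by (auto intro!: derivative_eq_intros simp: scaleR_conv_of_real mult_ac)
    show ?thesis
      using has_vector_derivative_mult[OF 1 2] by (simp add: algebra_simps)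
  qed
  then have "((\<lambda>s. of_real (D 1 s) * cis (a * s) + \<i> * of_real a * (of_real (D 0 s) * cis (a * s)))
      has_integral of_real (D 0 T) * cis (a * T) - of_real (D 0 0) * cis (a * 0)) {0..T}"
    using Suc.prems(3) by (intro fundamental_theorem_of_calculus) auto
  moreover have "((\<lambda>s. of_real (D 1 s) * cis (a * s) + \<i> * of_real a * (of_real (D 0 s) * cis (a * s)))
      has_integral I 1 + \<i> * of_real a * I 0) {0..T}"
    by (intro has_integral_add has_integral_mult_right int)
  ultimately have "I 1 + \<i> * of_real a * I 0 =
      of_real (D 0 T) * cis (a * T) - of_real (D 0 0) * cis (a * 0)"
    by (rule has_integral_unique[rotated])
  then have "I 1 = - (\<i> * of_real a * I 0)"
    using Suc.prems(4)[of 0] Suc.prems(5)[of 0] by (simp add: eq_neg_iff_add_eq_0)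
  then have "cmod (I 1) = \<bar>a\<bar> * cmod (I 0)"
    by (simp add: norm_mult)
  moreover have "\<bar>a\<bar> ^ m * cmod (I 1) \<le> T * B"
    unfolding I_def using Suc.IH[of "\<lambda>i. D (Suc i)"] Suc.prems by simp
  ultimately show ?case
    unfolding I_def by (simp add: mult_ac)
qed

text \<open>With \<open>y\<close> the signed distance of \<open>x\<close> to the nearest integer, \<open>\<bar>1 - cis (2\<pi>x)\<bar> = 2\<bar>sin (\<pi>y)\<bar> \<ge> 2\<bar>y\<bar>\<close>.
  This is the factor by which each summation by parts multiplies the sum.\<close>

lemma norm_one_minus_cis_ge:
  assumes "\<And>n :: int. \<bar>x - of_int n\<bar> \<ge> \<delta>"
  shows "\<delta> \<le> cmod (1 - cis (2 * pi * x))"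
proof -
  define y where "y = x - of_int (round x)"
  have y: "\<bar>y\<bar> \<le> 1 / 2"
    unfolding y_def using of_int_round_abs_le[of x] by (simp add: abs_minus_commute)
  have "cis (2 * pi * x) = cis (2 * pi * y)"
  proof -
    have "2 * pi * x = 2 * pi * y + 2 * pi * of_int (round x)"
      by (simp add: y_def algebra_simps)
    then show ?thesis by (simp add: cis_mult[symmetric] cis_multiple_2pi)
  qed
  then have "cmod (1 - cis (2 * pi * x)) = 2 * \<bar>sin (pi * y)\<bar>"
    using dist_exp_i_1[of "2 * pi * y"] by (simp add: cis_conv_exp norm_minus_commute mult_ac)
  moreover have "\<bar>y\<bar> \<le> \<bar>sin (pi * y)\<bar>"
  proof -
    have "t \<le> sin (pi * t)" if t: "0 \<le> t" "t \<le> 1/2" for t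
    proof -
      let ?y = "pi * t"
      \<comment> \<open>Since \<open>\<pi>t \<le> 2\<close>, the cubic Taylor bound gives at least a third of \<open>\<pi>t\<close>, and \<open>\<pi> > 3\<close>.\<close>
      have "\<bar>sin ?y - (\<Sum>m<3. sin_coeff m * ?y ^ m)\<bar> \<le> inverse (fact 3) * \<bar>?y\<bar> ^ 3"
        by (rule Maclaurin_sin_bound)
      moreover have "(\<Sum>m<3. sin_coeff m * ?y ^ m) = ?y"
        by (simp add: sin_coeff_def eval_nat_numeral)
      moreover have "\<bar>?y\<bar> = ?y" using t by simp
      ultimately have "sin ?y \<ge> ?y - ?y ^ 3 / 6"
        using abs_ge_minus_self[of "sin ?y - ?y"] by (simp add: fact_numeral field_simps)
      moreover have "?y \<le> 2"
        using mult_mono[of pi 4 t "1/2"] pi_less_4 t by simp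
      then have "?y * (?y ^ 2) \<le> ?y * 2 ^ 2"
        using t by (intro mult_left_mono power_mono) auto
      then have "?y ^ 3 \<le> 4 * ?y"
        by (simp add: power3_eq_cube power2_eq_square)
      moreover have "3 * t \<le> ?y"
        using t pi_gt3 by (intro mult_right_mono) auto
      ultimately show ?thesis using t by linarith
    qed
    from this[of "\<bar>y\<bar>"] y show ?thesis
      by (auto simp: abs_if split: if_splits)
  qed
  moreover have "\<delta> \<le> \<bar>y\<bar>" using assms[of "round x"] by (simp add: y_def)
  ultimately show ?thesis by linarith
qed


text \<open>Summation by parts with step \<open>h = 1/N\<close> gives at most \<open>N + m\<close> terms of size \<open>N\<close> to the power \<open>-m\<close>, and
  the normalization divides by a multiple of \<open>N\<close>. The constant is uniform in the frequency \<open>x\<close>,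
  as is needed to sum over all Fourier modes afterwards.\<close>

lemma weighted_sum_bound:
  "\<exists>C\<ge>0. \<forall>N\<ge>4. \<forall>x \<delta>. \<delta> > 0 \<longrightarrow> (\<forall>n :: int. \<delta> \<le> \<bar>x - of_int n\<bar>) \<longrightarrow>
    cmod ((1 / (\<Sum>n<N. weight (real n / real N))) *\<^sub>R
      (\<Sum>n<N. weight (real n / real N) *\<^sub>R cis (2 * pi * (real n * x)))) \<le> C / (\<delta> ^ m * real N ^ m)"
proof -
  obtain D M where D: "D 0 = weight" "\<And>n x. (D n has_real_derivative D (Suc n) x) (at x)"
    "\<And>n x. x \<le> 0 \<or> x \<ge> 1 \<Longrightarrow> D n x = 0" "\<And>n x. \<bar>D n x\<bar> \<le> M n"
    using weight_derivatives by metis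
  obtain c where c: "c > 0" "\<And>N. N \<ge> 4 \<Longrightarrow> (\<Sum>n<N. weight (real n / real N)) \<ge> c * real N"
    using weight_sum_lower_bound by metis
  have "M m \<ge> 0" using D(4)[of m 0] by linarith
  have bound: "cmod ((1 / (\<Sum>n<N. weight (real n / real N))) *\<^sub>R
      (\<Sum>n<N. weight (real n / real N) *\<^sub>R cis (2 * pi * (real n * x))))
      \<le> (real (m + 1) * M m / c) / (\<delta> ^ m * real N ^ m)"
    if N: "N \<ge> 4" and \<delta>: "\<delta> > 0" "\<And>n :: int. \<bar>x - of_int n\<bar> \<ge> \<delta>" for N x \<delta>
  proof -
    define S where "S = (\<Sum>n<N. weight (real n / real N) *\<^sub>R cis (2 * pi * (real n * x)))"
    define A where "A = (\<Sum>n<N. weight (real n / real N))"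
    define z where "z = cis (2 * pi * x)"
    have N0: "real N > 0" using N by simp
    have A: "A \<ge> c * real N" "A > 0"
      using c(2)[OF N] mult_pos_pos[OF c(1) N0] unfolding A_def by linarith+
    \<comment> \<open>The \<open>m\<close> extra terms vanish; they are the room that \<open>m\<close> differences need on the right.\<close>
    have "(\<Sum>n<N + m. of_real (D 0 (real n * (1 / real N))) * z ^ n) =
        (\<Sum>n<N. of_real (D 0 (real n * (1 / real N))) * z ^ n)"
      using N0 by (intro sum.mono_neutral_right) (auto simp: D(3))
    also have "\<dots> = S"
      unfolding S_def z_def
      by (intro sum.cong) (simp_all add: D(1) Complex.DeMoivre scaleR_conv_of_real mult_ac)
    finally have S: "(\<Sum>n<N + m. of_real (D 0 (real n * (1 / real N))) * z ^ n) = S" .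
    have "\<delta> ^ m * cmod S \<le> cmod (1 - z) ^ m * cmod S"
      using norm_one_minus_cis_ge[OF \<delta>(2)] \<delta>(1) unfolding z_def
      by (intro mult_right_mono power_mono) auto
    also have "\<dots> \<le> real (N + m) * ((1 / real N) ^ m * M m)"
      unfolding S[symmetric]
    proof (rule summation_by_parts_bound)
      fix t :: real assume "t \<le> 0 \<or> (real (N + m) - real m) * (1 / real N) \<le> t"
      then show "D 0 t = 0" using N0 by (intro D(3)) simp
    qed (use D(2,4) in \<open>simp_all add: z_def\<close>)
    also have "\<dots> \<le> (real (m + 1) * real N) * ((1 / real N) ^ m * M m)"
    proof (rule mult_right_mono)
      have "m * 1 \<le> m * N" using N by (intro mult_left_mono) auto
      then have "N + m \<le> (m + 1) * N" by simp
      then show "real (N + m) \<le> real (m + 1) * real N"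
        by (metis of_nat_le_iff of_nat_mult)
    qed (use \<open>M m \<ge> 0\<close> in simp)
    finally have "\<delta> ^ m * cmod S * real N ^ m \<le>
        (real (m + 1) * real N) * ((1 / real N) ^ m * M m) * real N ^ m"
      by (rule mult_right_mono) simp
    also have "\<dots> = real (m + 1) * real N * M m"
      using N0 by (simp add: power_one_over)
    finally have "cmod S \<le> real (m + 1) * real N * M m / (\<delta> ^ m * real N ^ m)"
      using \<delta>(1) N0 by (subst pos_le_divide_eq) (simp_all add: mult_ac)
    then have "cmod S / A \<le> (real (m + 1) * real N * M m / (\<delta> ^ m * real N ^ m)) / (c * real N)"
      using A c(1) N0 \<open>M m \<ge> 0\<close> \<delta>(1) by (intro frac_le) auto
    also have "\<dots> = (real (m + 1) * M m / c) / (\<delta> ^ m * real N ^ m)"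
      using N0 c(1) by simp
    finally show ?thesis
      using A(2) by (simp add: S_def A_def)
  qed
  have "real (m + 1) * M m / c \<ge> 0"
    using \<open>M m \<ge> 0\<close> c(1) by simp
  then show ?thesis
    using bound by (intro exI[of _ "real (m + 1) * M m / c"] conjI allI impI) auto
qed

lemma weighted_integral_bound:
  "\<exists>C\<ge>0. \<forall>T>0. \<forall>x \<delta>. \<delta> > 0 \<longrightarrow> \<delta> \<le> \<bar>x\<bar> \<longrightarrow>
    cmod ((1 / T) *\<^sub>R integral {0..T} (\<lambda>s. weight (s / T) *\<^sub>R cis (2 * pi * (s * x))))
      \<le> C / (\<delta> ^ m * T ^ m)"
proof -
  obtain D M where D: "D 0 = weight" "\<And>n x. (D n has_real_derivative D (Suc n) x) (at x)"
    "\<And>n x. x \<le> 0 \<or> x \<ge> 1 \<Longrightarrow> D n x = 0" "\<And>n x. \<bar>D n x\<bar> \<le> M n"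
    using weight_derivatives by metis
  have "M m \<ge> 0" using D(4)[of m 0] by linarith
  have bound: "cmod ((1 / T) *\<^sub>R integral {0..T} (\<lambda>s. weight (s / T) *\<^sub>R cis (2 * pi * (s * x))))
      \<le> M m / (\<delta> ^ m * T ^ m)"
    if T: "T > 0" and \<delta>: "\<delta> > 0" "\<bar>x\<bar> \<ge> \<delta>" for T x \<delta> :: real
  proof -
    define I where "I = integral {0..T} (\<lambda>s. weight (s / T) *\<^sub>R cis (2 * pi * (s * x)))"
    have I: "I = integral {0..T} (\<lambda>s. of_real (D 0 (s / T) / T ^ 0) * cis (2 * pi * x * s))"
      unfolding I_def by (simp add: D(1) scaleR_conv_of_real mult_ac)
    have "1 * \<bar>x\<bar> \<le> \<bar>2 * pi\<bar> * \<bar>x\<bar>"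
      using pi_gt3 by (intro mult_right_mono) auto
    then have "\<delta> \<le> \<bar>2 * pi * x\<bar>"
      using \<delta>(2) by (simp add: abs_mult)
    then have "\<delta> ^ m * cmod I \<le> \<bar>2 * pi * x\<bar> ^ m * cmod I"
      using \<delta>(1) by (intro mult_right_mono power_mono) auto
    also have "\<dots> \<le> T * (M m / T ^ m)"
      unfolding I
    proof (rule integration_by_parts_bound)
      fix i s
      have "((\<lambda>s. s / T) has_real_derivative 1 / T) (at s)"
        by (rule DERIV_cdivide[OF DERIV_ident])
      then have "((\<lambda>s. D i (s / T)) has_real_derivative D (Suc i) (s / T) * (1 / T)) (at s)"
        by (rule DERIV_chain2[OF D(2)])
      then have "((\<lambda>s. D i (s / T) / T ^ i) has_real_derivative
          D (Suc i) (s / T) * (1 / T) / T ^ i) (at s)"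
        by (rule DERIV_cdivide)
      then show "((\<lambda>s. D i (s / T) / T ^ i) has_real_derivative D (Suc i) (s / T) / T ^ Suc i) (at s)"
        by simp
    qed (use T D(3,4) in \<open>simp_all add: divide_right_mono\<close>)
    finally have "\<delta> ^ m * cmod I * T ^ m \<le> T * (M m / T ^ m) * T ^ m"
      using T by (intro mult_right_mono) auto
    also have "\<dots> = T * M m"
      using T by simp
    finally have "cmod I / T \<le> M m / (\<delta> ^ m * T ^ m)"
      using \<delta>(1) T by (simp add: pos_le_divide_eq pos_divide_le_eq mult_ac)
    then show ?thesis
      using T by (simp add: I_def)
  qed
  show ?thesis
    using \<open>M m \<ge> 0\<close> bound by (intro exI[of _ "M m"] conjI allI impI) auto
qed

section \<open>Products of absolutely convergent series\<close>

lemma bounded_bilinear_times: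
  "bounded_bilinear ((*) :: 'b :: complex_banach_algebra \<Rightarrow> 'b \<Rightarrow> 'b)"
proof -
  obtain K where "\<forall>x y :: 'b. norm (x * y) \<le> K * norm x * norm y"
    using norm_mult_bounded by blast
  then show ?thesis
    by unfold_locales (auto simp: algebra_simps intro!: exI[of _ K])
qed

lemma bounded_bilinear_scaleC:
  "bounded_bilinear (scaleC :: complex \<Rightarrow> 'b :: complex_banach_algebra \<Rightarrow> 'b)"
proof unfold_locales
  fix r :: real and c :: complex and x :: 'b
  show "(r *\<^sub>R c) *\<^sub>C x = r *\<^sub>R (c *\<^sub>C x)"
    by (simp add: scaleR_conv_of_real flip: scaleC_of_real scaleC_scaleC)
  show "c *\<^sub>C (r *\<^sub>R x) = r *\<^sub>R (c *\<^sub>C x)"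
    by (simp add: scaleC_scaleC mult.commute flip: scaleC_of_real)
qed (auto simp: scaleC_add_left scaleC_add_right norm_scaleC intro!: exI[of _ 1])

lemma scaleC_one: "1 *\<^sub>C (x :: 'b :: complex_banach_algebra) = x"
  using scaleC_of_real[of 1 x] by simp

lemma ordered_prod_Suc:
  "l \<ge> 1 \<Longrightarrow> ordered_prod f (Suc l) = ordered_prod f l * f (Suc l)"
  by (cases l) auto

lemma ordered_prod_cong:
  "(\<And>j. j \<in> {1..l} \<Longrightarrow> f j = g j) \<Longrightarrow> ordered_prod f l = ordered_prod g l"
proof (induction l)
  case (Suc l)
  then show ?case by (cases "l = 0") (auto simp: ordered_prod_Suc)
qed simp

lemma ordered_prod_cis:
  assumes "l \<ge> 1"
  shows "ordered_prod (\<lambda>j. cis (t j) *\<^sub>C x j) l = cis (\<Sum>j=1..l. t j) *\<^sub>C ordered_prod x l"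
  using assms
proof (induction l rule: nat_induct_at_least)
  case (Suc l)
  then show ?case
    by (simp add: ordered_prod_Suc scaleC_mult_left scaleC_mult_right scaleC_scaleC cis_mult
        add.commute mult.commute)
qed simp

lemma norm_ordered_prod_le:
  assumes "l \<ge> 1"
  obtains C where "C \<ge> 0" "\<And>f :: nat \<Rightarrow> 'b :: complex_banach_algebra.
    norm (ordered_prod f l) \<le> C * (\<Prod>j=1..l. norm (f j))"
proof -
  obtain K where K: "K \<ge> 0" "\<And>x y :: 'b. norm (x * y) \<le> norm x * norm y * K"
    using bounded_bilinear.nonneg_bounded[OF bounded_bilinear_times] by blast
  have "norm (ordered_prod f l) \<le> K ^ (l - 1) * (\<Prod>j=1..l. norm (f j))" for f :: "nat \<Rightarrow> 'b"
    using assms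
  proof (induction l rule: nat_induct_at_least)
    case (Suc l)
    have "norm (ordered_prod f (Suc l)) \<le> norm (ordered_prod f l) * norm (f (Suc l)) * K"
      using Suc K by (simp add: ordered_prod_Suc)
    also have "\<dots> \<le> (K ^ (l - 1) * (\<Prod>j=1..l. norm (f j))) * norm (f (Suc l)) * K"
      using Suc K by (intro mult_right_mono) auto
    also have "\<dots> = K ^ (Suc l - 1) * (\<Prod>j=1..Suc l. norm (f j))"
      using Suc(1) by (cases l) (simp_all add: mult_ac)
    finally show ?case .
  qed simp
  then show ?thesis using that[of "K ^ (l - 1)"] K(1) by simp
qed

text \<open>Absolute convergence makes the double family summable with respect to the pair index; its sum is
  then computed as an iterated one.\<close>

lemma has_sum_mult_Times:
  fixes f :: "'i \<Rightarrow> 'b :: complex_banach_algebra" and g :: "'j \<Rightarrow> 'b"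
  assumes "(f has_sum a) A" "(\<lambda>x. norm (f x)) summable_on A" "(g has_sum b) B" "(\<lambda>x. norm (g x)) summable_on B"
  shows "((\<lambda>(x, y). f x * g y) has_sum a * b) (A \<times> B)"
    and "(\<lambda>p. norm (case p of (x, y) \<Rightarrow> f x * g y)) summable_on A \<times> B"
proof -
  interpret bounded_bilinear "(*) :: 'b \<Rightarrow> 'b \<Rightarrow> 'b"
    by (rule bounded_bilinear_times)
  obtain K where K: "K \<ge> 0" "\<And>x y :: 'b. norm (x * y) \<le> norm x * norm y * K"
    using nonneg_bounded by blast
  show abs: "(\<lambda>p. norm (case p of (x, y) \<Rightarrow> f x * g y)) summable_on A \<times> B"
    unfolding Infinite_Sum.abs_summable_on_Sigma_iff
  proof (intro conjI ballI)
    have inner: "(\<lambda>y. norm (f x) * K * norm (g y)) summable_on B" for x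
      by (intro summable_on_cmult_right assms)
    show *: "(\<lambda>y. norm (case (x, y) of (x, y) \<Rightarrow> f x * g y)) summable_on B" for x
      by (rule Infinite_Sum.abs_summable_on_comparison_test'[OF inner[of x]])
        (use K(2) in \<open>simp add: mult_ac\<close>)
    have outer: "(\<lambda>x. norm (f x) * (K * infsum (\<lambda>y. norm (g y)) B)) summable_on A"
      by (intro summable_on_cmult_left assms)
    show "(\<lambda>x. norm (\<Sum>\<^sub>\<infinity>y\<in>B. norm (case (x, y) of (x, y) \<Rightarrow> f x * g y))) summable_on A"
    proof (rule Infinite_Sum.abs_summable_on_comparison_test'[OF outer])
      fix x
      have "(\<Sum>\<^sub>\<infinity>y\<in>B. norm (case (x, y) of (x, y) \<Rightarrow> f x * g y)) \<le>
          (\<Sum>\<^sub>\<infinity>y\<in>B. norm (f x) * K * norm (g y))"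
        using K(2) by (intro infsum_mono * inner) (simp add: mult_ac)
      also have "\<dots> = norm (f x) * (K * infsum (\<lambda>y. norm (g y)) B)"
        by (simp add: infsum_cmult_right' mult_ac)
      finally show "norm (\<Sum>\<^sub>\<infinity>y\<in>B. norm (case (x, y) of (x, y) \<Rightarrow> f x * g y)) \<le>
          norm (f x) * (K * infsum (\<lambda>y. norm (g y)) B)"
        by (simp add: infsum_nonneg)
    qed
  qed
  obtain S where S: "((\<lambda>(x, y). f x * g y) has_sum S) (A \<times> B)"
    using abs_summable_summable[OF abs] summable_on_def by blast
  have "((\<lambda>x. f x * b) has_sum S) A"
    using S by (rule has_sum_SigmaD)
      (simp add: has_sum_bounded_linear[OF bounded_linear_right assms(3)])
  moreover have "((\<lambda>x. f x * b) has_sum a * b) A"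
    by (rule has_sum_bounded_linear[OF bounded_linear_left assms(1)])
  ultimately have "S = a * b" by (rule infsumI[THEN trans[OF sym], OF _ infsumI])
  then show "((\<lambda>(x, y). f x * g y) has_sum a * b) (A \<times> B)"
    using S by simp
qed

text \<open>Absolute convergence is part of the conclusion because the induction multiplies the partial product
  by one more series.\<close>

lemma has_sum_ordered_prod:
  fixes f :: "nat \<Rightarrow> 'i \<Rightarrow> 'b :: complex_banach_algebra"
  assumes "l \<ge> 1"
    and "\<And>j. j \<in> {1..l} \<Longrightarrow> (f j has_sum s j) A"
    and "\<And>j. j \<in> {1..l} \<Longrightarrow> (\<lambda>x. norm (f j x)) summable_on A"
  shows "((\<lambda>k. ordered_prod (\<lambda>j. f j (k j)) l) has_sum ordered_prod s l) (\<Pi>\<^sub>E j\<in>{1..l}. A) \<and>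
    (\<lambda>k. norm (ordered_prod (\<lambda>j. f j (k j)) l)) summable_on (\<Pi>\<^sub>E j\<in>{1..l}. A)"
  using assms
proof (induction l rule: nat_induct_at_least)
  case base
  have eq: "(\<Pi>\<^sub>E j\<in>{1..1}. A) = (\<lambda>x. \<lambda>j\<in>{1::nat}. x) ` A"
  proof (intro equalityI subsetI)
    fix k :: "nat \<Rightarrow> 'i" assume k: "k \<in> (\<Pi>\<^sub>E j\<in>{1..1}. A)"
    then have "k = (\<lambda>j\<in>{1}. k 1)"
      by (intro ext) (auto simp: PiE_def extensional_def)
    moreover have "k 1 \<in> A" using k by auto
    ultimately show "k \<in> (\<lambda>x. \<lambda>j\<in>{1::nat}. x) ` A" by (rule image_eqI)
  qed (auto split: if_splits)
  have inj: "inj_on (\<lambda>x. \<lambda>j\<in>{1::nat}. x) A"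
    by (rule inj_onI) (metis restrict_apply singletonI)
  show ?case
    unfolding eq has_sum_reindex[OF inj] summable_on_reindex[OF inj]
    using base[of 1] by (simp add: o_def)
next
  case (Suc l)
  let ?P = "\<lambda>l k. ordered_prod (\<lambda>j. f j (k j)) l"
  let ?h = "\<lambda>(y, g). g(Suc l := y)"
  have IH: "(?P l has_sum ordered_prod s l) (\<Pi>\<^sub>E j\<in>{1..l}. A)" "(\<lambda>k. norm (?P l k)) summable_on (\<Pi>\<^sub>E j\<in>{1..l}. A)"
    using Suc.IH Suc.prems by auto
  have f: "(f (Suc l) has_sum s (Suc l)) A" "(\<lambda>x. norm (f (Suc l) x)) summable_on A"
    using Suc.prems by auto
  define h :: "(nat \<Rightarrow> 'i) \<times> 'i \<Rightarrow> nat \<Rightarrow> 'i" where "h = (\<lambda>(g, y). g(Suc l := y))"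
  have "?h ` (A \<times> (\<Pi>\<^sub>E j\<in>{1..l}. A)) = h ` ((\<Pi>\<^sub>E j\<in>{1..l}. A) \<times> A)"
    by (force simp: h_def image_iff)
  then have eq: "(\<Pi>\<^sub>E j\<in>{1..Suc l}. A) = h ` ((\<Pi>\<^sub>E j\<in>{1..l}. A) \<times> A)"
    using PiE_insert_eq[of "Suc l" "{1..l}" "\<lambda>_. A"] by (simp add: atLeastAtMostSuc_conv)
  have inj: "inj_on h ((\<Pi>\<^sub>E j\<in>{1..l}. A) \<times> A)"
    using inj_combinator[of "Suc l" "{1..l}" "\<lambda>_. A"] unfolding h_def inj_on_def by simp
  have P: "?P (Suc l) \<circ> h = (\<lambda>(k, x). ?P l k * f (Suc l) x)"
  proof
    fix p :: "(nat \<Rightarrow> 'i) \<times> 'i"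
    obtain k x where p: "p = (k, x)" by fastforce
    have "ordered_prod (\<lambda>j. f j (h p j)) l = ?P l k"
      by (rule ordered_prod_cong) (auto simp: h_def p)
    then show "(?P (Suc l) \<circ> h) p = (case p of (k, x) \<Rightarrow> ?P l k * f (Suc l) x)"
      using Suc(1) by (simp add: p ordered_prod_Suc) (simp add: h_def)
  qed
  then have nP: "(\<lambda>k. norm (?P (Suc l) k)) \<circ> h = (\<lambda>p. norm (case p of (k, x) \<Rightarrow> ?P l k * f (Suc l) x))"
    by (metis comp_assoc comp_def)
  show ?case
    unfolding eq has_sum_reindex[OF inj] summable_on_reindex[OF inj] P nP
    using Suc(1) has_sum_mult_Times[OF IH f] by (simp add: ordered_prod_Suc)
qed

section \<open>Weighted summability of the Fourier coefficients\<close>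

text \<open>Split the index set according to the set \<open>J\<close> of coordinates equal to \<open>z\<close>. There are finitely many
  such pieces, and on each of them the replacement of \<open>z\<close> by \<open>e\<close> is injective.\<close>

lemma summable_on_replace_default:
  fixes T :: "('i \<Rightarrow> 'a) \<Rightarrow> real"
  assumes "finite I" "e \<noteq> z"
    and "T summable_on (\<Pi>\<^sub>E j\<in>I. UNIV - {z})"
  shows "(\<lambda>k. T (\<lambda>j\<in>I. if k j = z then e else k j)) summable_on (\<Pi>\<^sub>E j\<in>I. UNIV)"
proof -
  define fill where "fill k = (\<lambda>j\<in>I. if k j = z then e else k j)" for k :: "'i \<Rightarrow> 'a"
  define B where "B J = {k \<in> \<Pi>\<^sub>E j\<in>I. UNIV. \<forall>j\<in>I. k j = z \<longleftrightarrow> j \<in> J}" for J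
  have "(\<lambda>k. T (fill k)) summable_on (\<Union>J\<in>Pow I. B J)"
  proof (rule summable_on_finite_union_disjoint)
    fix J assume "J \<in> Pow I"
    have "inj_on fill (B J)"
    proof (rule inj_onI)
      fix k k' assume k: "k \<in> B J" "k' \<in> B J" "fill k = fill k'"
      show "k = k'"
      proof
        fix j
        show "k j = k' j"
        proof (cases "j \<in> I")
          case True
          then show ?thesis
            using k(1,2) fun_cong[OF k(3), of j] by (auto simp: B_def fill_def split: if_splits)
        next
          case False
          then show ?thesis using k(1,2) by (auto simp: B_def PiE_def extensional_def)
        qed
      qed
    qed
    moreover have "fill ` B J \<subseteq> (\<Pi>\<^sub>E j\<in>I. UNIV - {z})"
      using assms(2) by (auto simp: fill_def split: if_splits)
    then have "T summable_on (fill ` B J)"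
      using summable_on_subset_banach[OF assms(3)] by blast
    ultimately show "(\<lambda>k. T (fill k)) summable_on B J"
      by (simp add: summable_on_reindex o_def)
  qed (use assms(1) in \<open>auto simp: B_def\<close>)
  moreover have "(\<Union>J\<in>Pow I. B J) = (\<Pi>\<^sub>E j\<in>I. UNIV)"
  proof
    show "(\<Pi>\<^sub>E j\<in>I. UNIV) \<subseteq> (\<Union>J\<in>Pow I. B J)"
    proof
      fix k :: "'i \<Rightarrow> 'a" assume "k \<in> (\<Pi>\<^sub>E j\<in>I. UNIV)"
      then have "k \<in> B {j \<in> I. k j = z}" by (auto simp: B_def)
      then show "k \<in> (\<Union>J\<in>Pow I. B J)"
        by (rule UN_I[rotated]) simp
    qed
  qed (simp add: B_def UN_subset_iff)
  ultimately show ?thesis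
    unfolding fill_def by simp
qed

text \<open>Any fixed nonzero vector would serve in place of the zero block; here all its entries are 1.\<close>

definition nonzero_block :: "int ^ 'd \<Rightarrow> int ^ 'd"
  where "nonzero_block k = (if k = 0 then 1 else k)"

lemma nonzero_block_neq_0: "nonzero_block k \<noteq> 0"
  by (simp add: nonzero_block_def)

lemma l1norm_nonneg: "0 \<le> l1norm k"
  by (simp add: l1norm_def sum_nonneg)

lemma l1norm_ge_1:
  assumes "k \<noteq> 0" shows "1 \<le> l1norm k"
proof -
  obtain i where i: "k $ i \<noteq> 0"
    using assms by (auto simp: vec_eq_iff)
  then have "1 \<le> \<bar>real_of_int (k $ i)\<bar>"
    by (simp flip: of_int_abs)
  also have "\<dots> \<le> l1norm k"
    unfolding l1norm_def by (rule member_le_sum) auto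
  finally show ?thesis .
qed

lemma l1norm_nonzero_block:
  "l1norm k \<le> l1norm (nonzero_block k)" "1 \<le> l1norm (nonzero_block k)"
proof -
  show "1 \<le> l1norm (nonzero_block k)"
    by (rule l1norm_ge_1[OF nonzero_block_neq_0])
  then show "l1norm k \<le> l1norm (nonzero_block k)"
    by (auto simp: nonzero_block_def l1norm_def)
qed

lemma approximation_function_ge_1: "approximation_function \<Delta> \<Longrightarrow> 1 \<le> x \<Longrightarrow> 1 \<le> \<Delta> x"
  by (simp add: approximation_function_def)

lemma approximation_function_mono:
  assumes "approximation_function \<Delta>" "1 \<le> x" "x \<le> y"
  shows "\<Delta> x \<le> \<Delta> y"
proof (cases "x = y")
  case False
  then show ?thesis
    using assms strict_mono_onD[of "{1..}" \<Delta> x y] by (auto simp: approximation_function_def)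
qed simp

text \<open>The space controls only coefficients of nonzero index. With \<open>nonzero_block\<close> the coefficient of
  index 0 obeys a bound of the same form, after enlarging the constant.\<close>

lemma fourier_coeff_bound:
  assumes "F \<in> fourier_space \<Delta>" "approximation_function \<Delta>"
  obtains B where "B \<ge> 0" "\<And>k. norm (fourier_coeff F k) \<le> B / \<Delta> (l1norm (nonzero_block k))"
proof -
  from assms(1) obtain b where b: "\<And>k. k \<noteq> 0 \<Longrightarrow> \<Delta> (l1norm k) * norm (fourier_coeff F k) \<le> b"
    unfolding fourier_space_def bdd_above_def by fastforce
  define B where "B = max \<bar>b\<bar> (\<Delta> (l1norm (nonzero_block (0 :: int ^ 'a))) * norm (fourier_coeff F 0))"
  have "norm (fourier_coeff F k) \<le> B / \<Delta> (l1norm (nonzero_block k))" for k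
  proof -
    have "0 < \<Delta> (l1norm (nonzero_block k))"
      using approximation_function_ge_1[OF assms(2) l1norm_nonzero_block(2)[of k]] by linarith
    moreover have "norm (fourier_coeff F k) * \<Delta> (l1norm (nonzero_block k)) \<le> B"
    proof (cases "k = 0")
      case False
      then show ?thesis
        using b[of k] by (simp add: B_def nonzero_block_def mult.commute)
    qed (simp add: B_def mult.commute)
    ultimately show ?thesis by (simp add: pos_le_divide_eq)
  qed
  moreover have "B \<ge> 0" by (simp add: B_def)
  ultimately show ?thesis using that by blast
qed

text \<open>Freeze all blocks but the \<open>i\<close>-th at the vector with all entries 1. Since \<open>\<Delta> \<ge> 1\<close>, the frozen family dominates
  the reciprocals of \<open>\<Delta>' i\<close> up to a constant. This makes every single Fourier series absolutely
  convergent, so that the series can be multiplied.\<close>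

lemma summable_single_block:
  fixes \<Delta> :: "real \<Rightarrow> real" and \<Delta>' :: "nat \<Rightarrow> real \<Rightarrow> real"
  assumes \<Delta>: "approximation_function \<Delta>"
    and \<Delta>': "\<And>j. j \<in> {1..l} \<Longrightarrow> approximation_function (\<Delta>' j)"
    and summable: "(\<lambda>k :: nat \<Rightarrow> int ^ 'd. \<Delta> (\<Sum>j=1..l. l1norm (k j)) ^ m /
        (\<Prod>j=1..l. \<Delta>' j (l1norm (k j)))) summable_on (\<Pi>\<^sub>E j\<in>{1..l}. UNIV - {0})"
    and i: "i \<in> {1..l}"
  shows "(\<lambda>c :: int ^ 'd. 1 / \<Delta>' i (l1norm (nonzero_block c))) summable_on UNIV"
proof -
  define h :: "int ^ 'd \<Rightarrow> nat \<Rightarrow> int ^ 'd" where "h c = (\<lambda>j\<in>{1..l}. if j = i then c else 1)" for c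
  define T where "T k = \<Delta> (\<Sum>j=1..l. l1norm (k j)) ^ m / (\<Prod>j=1..l. \<Delta>' j (l1norm (k j)))"
    for k :: "nat \<Rightarrow> int ^ 'd"
  define P where "P = (\<Prod>j\<in>{1..l} - {i}. \<Delta>' j (l1norm (1 :: int ^ 'd)))"
  have one: "1 \<le> l1norm (1 :: int ^ 'd)" by (rule l1norm_ge_1) simp
  have P: "P > 0"
    unfolding P_def
    by (rule prod_pos) (use approximation_function_ge_1[OF \<Delta>' one] in force)
  have "inj_on h (UNIV - {0})"
  proof (rule inj_onI)
    fix c c' assume "h c = h c'"
    from fun_cong[OF this, of i] show "c = c'" using i by (simp add: h_def)
  qed
  moreover have "T summable_on h ` (UNIV - {0})"
  proof (rule summable_on_subset_banach)
    show "T summable_on (\<Pi>\<^sub>E j\<in>{1..l}. UNIV - {0})"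
      using summable by (simp add: T_def[abs_def])
    show "h ` (UNIV - {0}) \<subseteq> (\<Pi>\<^sub>E j\<in>{1..l}. UNIV - {0})"
      by (auto simp: h_def split: if_splits)
  qed
  ultimately have "(\<lambda>c. P * T (h c)) summable_on UNIV - {0}"
    by (intro summable_on_cmult_right) (simp add: summable_on_reindex o_def)
  then have "(\<lambda>c :: int ^ 'd. 1 / \<Delta>' i (l1norm (nonzero_block c))) summable_on UNIV - {0}"
  proof (rule summable_on_comparison_test)
    fix c :: "int ^ 'd" assume "c \<in> UNIV - {0}"
    then have c: "nonzero_block c = c" "1 \<le> l1norm c"
      by (auto simp: nonzero_block_def l1norm_ge_1)
    have D: "\<Delta>' i (l1norm c) \<ge> 1"
      using approximation_function_ge_1[OF \<Delta>'[OF i] c(2)] .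
    then show "0 \<le> 1 / \<Delta>' i (l1norm (nonzero_block c))"
      using c by simp
    have "(\<Prod>j=1..l. \<Delta>' j (l1norm (h c j))) =
        \<Delta>' i (l1norm (h c i)) * (\<Prod>j\<in>{1..l} - {i}. \<Delta>' j (l1norm (h c j)))"
      using i by (intro prod.remove) auto
    also have "\<dots> = \<Delta>' i (l1norm c) * P"
      using i by (auto simp: h_def P_def intro!: prod.cong)
    finally have prod: "(\<Prod>j=1..l. \<Delta>' j (l1norm (h c j))) = \<Delta>' i (l1norm c) * P" .
    have "l1norm (h c i) \<le> (\<Sum>j=1..l. l1norm (h c j))"
      using i by (intro member_le_sum) (auto simp: l1norm_nonneg)
    then have "1 \<le> (\<Sum>j=1..l. l1norm (h c j))"
      using c i by (simp add: h_def)
    then have "1 \<le> \<Delta> (\<Sum>j=1..l. l1norm (h c j)) ^ m"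
      using approximation_function_ge_1[OF \<Delta>] by (simp add: one_le_power)
    then have "1 / \<Delta>' i (l1norm c) \<le> \<Delta> (\<Sum>j=1..l. l1norm (h c j)) ^ m / \<Delta>' i (l1norm c)"
      using D by (intro divide_right_mono) auto
    also have "\<dots> = P * T (h c)"
      unfolding T_def prod using P by simp
    finally show "1 / \<Delta>' i (l1norm (nonzero_block c)) \<le> P * T (h c)"
      by (simp add: c)
  qed
  then show ?thesis
    using summable_on_insert_iff[of "\<lambda>c :: int ^ 'd. 1 / \<Delta>' i (l1norm (nonzero_block c))" 0 "UNIV - {0}"]
    by (simp add: insert_UNIV)
qed

text \<open>The coefficient bounds dominate each term by a constant multiple of the summand of the hypothesis
  at the multi-index with zero blocks replaced.\<close>

lemma summable_weighted_coefficients: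
  fixes \<Delta> :: "real \<Rightarrow> real" and \<Delta>' :: "nat \<Rightarrow> real \<Rightarrow> real"
    and F :: "nat \<Rightarrow> real ^ 'd \<Rightarrow> 'b :: complex_banach_algebra"
  assumes l: "l \<ge> 1" and \<Delta>: "approximation_function \<Delta>"
    and \<Delta>': "\<And>j. j \<in> {1..l} \<Longrightarrow> approximation_function (\<Delta>' j)"
    and F: "\<And>j. j \<in> {1..l} \<Longrightarrow> F j \<in> fourier_space (\<Delta>' j)"
    and summable: "(\<lambda>k :: nat \<Rightarrow> int ^ 'd. \<Delta> (\<Sum>j=1..l. l1norm (k j)) ^ m /
        (\<Prod>j=1..l. \<Delta>' j (l1norm (k j)))) summable_on (\<Pi>\<^sub>E j\<in>{1..l}. UNIV - {0})"
  shows "(\<lambda>k. \<Delta> (\<Sum>j=1..l. l1norm (nonzero_block (k j))) ^ m *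
      norm (ordered_prod (\<lambda>j. fourier_coeff (F j) (k j)) l)) summable_on (\<Pi>\<^sub>E j\<in>{1..l}. UNIV)"
proof -
  have "\<exists>B\<ge>0. \<forall>k. norm (fourier_coeff (F j) k) \<le> B / \<Delta>' j (l1norm (nonzero_block k))"
    if "j \<in> {1..l}" for j
    using fourier_coeff_bound[OF F[OF that] \<Delta>'[OF that]] by metis
  then obtain B where B: "\<And>j. j \<in> {1..l} \<Longrightarrow> B j \<ge> 0"
    "\<And>j k. j \<in> {1..l} \<Longrightarrow> norm (fourier_coeff (F j) k) \<le> B j / \<Delta>' j (l1norm (nonzero_block k))"
    by metis
  obtain C where C: "C \<ge> 0" "\<And>f :: nat \<Rightarrow> 'b. norm (ordered_prod f l) \<le> C * (\<Prod>j=1..l. norm (f j))"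
    using norm_ordered_prod_le[OF l] by metis
  define W where "W k = \<Delta> (\<Sum>j=1..l. l1norm (nonzero_block (k j))) ^ m" for k :: "nat \<Rightarrow> int ^ 'd"
  define Q where "Q k = (\<Prod>j=1..l. \<Delta>' j (l1norm (nonzero_block (k j))))" for k :: "nat \<Rightarrow> int ^ 'd"
  have W: "W k \<ge> 0" for k
  proof -
    have "l1norm (nonzero_block (k 1)) \<le> (\<Sum>j=1..l. l1norm (nonzero_block (k j)))"
      using l by (intro member_le_sum) (auto simp: l1norm_nonneg)
    then have "1 \<le> \<Delta> (\<Sum>j=1..l. l1norm (nonzero_block (k j)))"
      using l1norm_nonzero_block(2)[of "k 1"] by (intro approximation_function_ge_1[OF \<Delta>]) linarith
    then show ?thesis by (simp add: W_def)
  qed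
  have blocks: "(\<Sum>j=1..l. l1norm ((\<lambda>j\<in>{1..l}. if k j = 0 then 1 else k j) j)) =
      (\<Sum>j=1..l. l1norm (nonzero_block (k j)))"
    "(\<Prod>j=1..l. \<Delta>' j (l1norm ((\<lambda>j\<in>{1..l}. if k j = 0 then 1 else k j) j))) = Q k"
    for k :: "nat \<Rightarrow> int ^ 'd"
    by (simp_all add: nonzero_block_def Q_def)
  have "(\<lambda>k. W k / Q k) summable_on (\<Pi>\<^sub>E j\<in>{1..l}. UNIV)"
    using summable_on_replace_default[OF _ _ summable, of 1] unfolding blocks W_def by simp
  then have "(\<lambda>k. C * (\<Prod>j=1..l. B j) * (W k / Q k)) summable_on (\<Pi>\<^sub>E j\<in>{1..l}. UNIV)"
    by (rule summable_on_cmult_right)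
  then have "(\<lambda>k. W k * norm (ordered_prod (\<lambda>j. fourier_coeff (F j) (k j)) l))
      summable_on (\<Pi>\<^sub>E j\<in>{1..l}. UNIV)"
  proof (rule summable_on_comparison_test)
    fix k :: "nat \<Rightarrow> int ^ 'd"
    have "norm (ordered_prod (\<lambda>j. fourier_coeff (F j) (k j)) l) \<le>
        C * (\<Prod>j=1..l. norm (fourier_coeff (F j) (k j)))"
      by (rule C(2))
    also have "\<dots> \<le> C * (\<Prod>j=1..l. B j / \<Delta>' j (l1norm (nonzero_block (k j))))"
      using B(2) C(1) by (intro mult_left_mono prod_mono) auto
    also have "\<dots> = C * (\<Prod>j=1..l. B j) / Q k"
      by (simp add: prod_dividef Q_def)
    finally have "W k * norm (ordered_prod (\<lambda>j. fourier_coeff (F j) (k j)) l) \<le>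
        W k * (C * (\<Prod>j=1..l. B j) / Q k)"
      by (rule mult_left_mono[OF _ W])
    then show "W k * norm (ordered_prod (\<lambda>j. fourier_coeff (F j) (k j)) l) \<le>
        C * (\<Prod>j=1..l. B j) * (W k / Q k)"
      by (simp add: mult_ac)
    show "0 \<le> W k * norm (ordered_prod (\<lambda>j. fourier_coeff (F j) (k j)) l)"
      using W by simp
  qed
  then show ?thesis by (simp add: W_def)
qed

section \<open>Fourier expansion along the orbit and its averages\<close>

lemma rot_in_torus: "rot \<rho> s \<theta> \<in> torus"
  by (simp add: rot_def torus_def less_imp_le[OF frac_lt_1])

text \<open>Reduction modulo 1 changes the scalar product with an integer vector by an integer only.\<close>

lemma cis_idot_rot:
  "cis (2 * pi * idot k (rot \<rho> s \<theta>)) = cis (2 * pi * (idot k \<theta> + s * idot k \<rho>))"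
proof -
  define n where "n = (\<Sum>i\<in>UNIV. k $ i * \<lfloor>\<theta> $ i + s * \<rho> $ i\<rfloor>)"
  have "idot k (rot \<rho> s \<theta>) = idot k \<theta> + s * idot k \<rho> - of_int n"
    by (simp add: idot_def rot_def frac_def n_def algebra_simps sum.distrib sum_subtractf
        sum_distrib_left)
  then have "2 * pi * (idot k \<theta> + s * idot k \<rho>) = 2 * pi * idot k (rot \<rho> s \<theta>) + 2 * pi * of_int n"
    by (metis diff_add_cancel distrib_left)
  then show ?thesis
    by (simp add: cis_mult[symmetric])
qed

lemma product_along_orbit_has_sum:
  fixes F :: "nat \<Rightarrow> real ^ 'd \<Rightarrow> 'b :: complex_banach_algebra"
  assumes l: "l \<ge> 1" and F: "\<And>j. j \<in> {1..l} \<Longrightarrow> F j \<in> fourier_space (\<Delta>' j)"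
    and abs: "\<And>j. j \<in> {1..l} \<Longrightarrow> (\<lambda>k. norm (fourier_coeff (F j) k)) summable_on UNIV"
  shows "((\<lambda>k. cis (2 * pi * (s * (\<Sum>j=1..l. idot (k j) (\<rho> j)))) *\<^sub>C
        (cis (2 * pi * (\<Sum>j=1..l. idot (k j) \<theta>)) *\<^sub>C ordered_prod (\<lambda>j. fourier_coeff (F j) (k j)) l))
      has_sum ordered_prod (\<lambda>j. F j (rot (\<rho> j) s \<theta>)) l) (\<Pi>\<^sub>E j\<in>{1..l}. UNIV)"
proof -
  define t where "t j c = 2 * pi * (idot c \<theta> + s * idot c (\<rho> j))" for j c
  have "((\<lambda>k. ordered_prod (\<lambda>j. cis (t j (k j)) *\<^sub>C fourier_coeff (F j) (k j)) l)
      has_sum ordered_prod (\<lambda>j. F j (rot (\<rho> j) s \<theta>)) l) (\<Pi>\<^sub>E j\<in>{1..l}. UNIV)"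
  proof (rule has_sum_ordered_prod[THEN conjunct1])
    fix j assume j: "j \<in> {1..l}"
    have "((\<lambda>k. cis (2 * pi * idot k (rot (\<rho> j) s \<theta>)) *\<^sub>C fourier_coeff (F j) k)
        has_sum F j (rot (\<rho> j) s \<theta>)) UNIV"
      using F[OF j] rot_in_torus unfolding fourier_space_def by blast
    then show "((\<lambda>c. cis (t j c) *\<^sub>C fourier_coeff (F j) c) has_sum F j (rot (\<rho> j) s \<theta>)) UNIV"
      by (simp add: cis_idot_rot t_def)
    show "(\<lambda>c. norm (cis (t j c) *\<^sub>C fourier_coeff (F j) c)) summable_on UNIV"
      using abs[OF j] by (simp add: norm_scaleC)
  qed (rule l)
  moreover have "ordered_prod (\<lambda>j. cis (t j (k j)) *\<^sub>C fourier_coeff (F j) (k j)) l =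
      cis (2 * pi * (s * (\<Sum>j=1..l. idot (k j) (\<rho> j)))) *\<^sub>C
        (cis (2 * pi * (\<Sum>j=1..l. idot (k j) \<theta>)) *\<^sub>C ordered_prod (\<lambda>j. fourier_coeff (F j) (k j)) l)"
    for k
  proof -
    have "(\<Sum>j=1..l. t j (k j)) =
        2 * pi * (s * (\<Sum>j=1..l. idot (k j) (\<rho> j))) + 2 * pi * (\<Sum>j=1..l. idot (k j) \<theta>)"
      by (simp add: t_def sum.distrib sum_distrib_left algebra_simps)
    then show ?thesis
      by (simp add: ordered_prod_cis[OF l] scaleC_scaleC cis_mult)
  qed
  ultimately show ?thesis by simp
qed

lemma has_sum_sum_finite:
  fixes f :: "'i \<Rightarrow> 'k \<Rightarrow> 'a :: topological_comm_monoid_add"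
  assumes "finite I" "\<And>i. i \<in> I \<Longrightarrow> (f i has_sum s i) A"
  shows "((\<lambda>x. \<Sum>i\<in>I. f i x) has_sum (\<Sum>i\<in>I. s i)) A"
  using assms by (induction I) (simp_all add: has_sum_add)

lemma discrete_average_has_sum:
  fixes H :: "'k \<Rightarrow> 'b :: complex_banach_algebra"
  assumes "\<And>n. ((\<lambda>k. cis (2 * pi * (real n * \<phi> k)) *\<^sub>C H k) has_sum P n) K"
  shows "((\<lambda>k. ((1 / A) *\<^sub>R (\<Sum>n<N. w n *\<^sub>R cis (2 * pi * (real n * \<phi> k)))) *\<^sub>C H k)
    has_sum (1 / A) *\<^sub>R (\<Sum>n<N. w n *\<^sub>R P n)) K"
proof -
  interpret bounded_bilinear "scaleC :: complex \<Rightarrow> 'b \<Rightarrow> 'b"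
    by (rule bounded_bilinear_scaleC)
  have "((\<lambda>k. (1 / A) *\<^sub>R (\<Sum>n<N. w n *\<^sub>R (cis (2 * pi * (real n * \<phi> k)) *\<^sub>C H k)))
    has_sum (1 / A) *\<^sub>R (\<Sum>n<N. w n *\<^sub>R P n)) K"
    by (intro has_sum_bounded_linear[OF bounded_linear_scaleR_right] has_sum_sum_finite assms) auto
  then show ?thesis
    by (simp only: scaleR_left sum_left)
qed

text \<open>The series converges uniformly on \<open>{0..T}\<close> by the Weierstrass test, so it may be integrated
  term by term.\<close>

lemma continuous_average_has_sum:
  fixes H :: "'k \<Rightarrow> 'b :: complex_banach_algebra"
  assumes P: "\<And>s. ((\<lambda>k. cis (2 * pi * (s * \<phi> k)) *\<^sub>C H k) has_sum P s) K"
    and abs: "(\<lambda>k. norm (H k)) summable_on K"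
    and w: "continuous_on {0..T} w"
  shows "((\<lambda>k. (c *\<^sub>R integral {0..T} (\<lambda>s. w s *\<^sub>R cis (2 * pi * (s * \<phi> k)))) *\<^sub>C H k)
    has_sum c *\<^sub>R integral {0..T} (\<lambda>s. w s *\<^sub>R P s)) K"
proof -
  interpret bounded_bilinear "scaleC :: complex \<Rightarrow> 'b \<Rightarrow> 'b"
    by (rule bounded_bilinear_scaleC)
  define f where "f k s = w s *\<^sub>R (cis (2 * pi * (s * \<phi> k)) *\<^sub>C H k)" for k s
  define g where "g k s = w s *\<^sub>R cis (2 * pi * (s * \<phi> k))" for k s
  have g: "continuous_on {0..T} (g k)" for k
    unfolding g_def by (intro continuous_intros w)
  have fg: "f k = (\<lambda>s. g k s *\<^sub>C H k)" for k
    by (rule ext) (simp add: f_def g_def scaleR_left)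
  have f: "continuous_on {0..T} (f k)" for k
    unfolding fg by (rule bounded_linear.continuous_on[OF bounded_linear_left g])
  have int: "integral {0..T} (f k) = integral {0..T} (g k) *\<^sub>C H k" for k
    using integral_linear[OF integrable_continuous_real[OF g[of k]] bounded_linear_left[of "H k"]]
    by (simp add: fg o_def)
  obtain M where M: "\<And>s. s \<in> {0..T} \<Longrightarrow> \<bar>w s\<bar> \<le> M"
    using compact_imp_bounded[OF compact_continuous_image[OF w compact_Icc]]
    unfolding bounded_iff by (metis imageI real_norm_def)
  have "uniform_limit {0..T} (\<lambda>X s. \<Sum>k\<in>X. f k s) (\<lambda>s. w s *\<^sub>R P s) (finite_subsets_at_top K)"
  proof (rule Weierstrass_m_test_general')
    show "norm (f k s) \<le> M * norm (H k)" if "s \<in> {0..T}" for k s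
      using M[OF that] by (simp add: f_def norm_scaleC mult_right_mono)
    show "((\<lambda>k. f k s) has_sum w s *\<^sub>R P s) K" for s
      unfolding f_def by (rule has_sum_bounded_linear[OF bounded_linear_scaleR_right P])
    show "(\<lambda>k. M * norm (H k)) summable_on K"
      by (rule summable_on_cmult_right[OF abs])
  qed
  moreover have "continuous_on {0..T} (\<lambda>s. \<Sum>k\<in>X. f k s)" for X
    by (intro continuous_on_sum f)
  ultimately obtain I J where IJ: "\<And>X. ((\<lambda>s. \<Sum>k\<in>X. f k s) has_integral I X) {0..T}"
    "((\<lambda>s. w s *\<^sub>R P s) has_integral J) {0..T}" "(I \<longlongrightarrow> J) (finite_subsets_at_top K)"
    by (rule uniform_limit_integral) auto
  have "I X = (\<Sum>k\<in>X. integral {0..T} (f k))" if "finite X" for X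
    using integral_unique[OF IJ(1)[of X]] integral_sum[OF that, of f "{0..T}"]
      integrable_continuous_real[OF f] by simp
  then have "((\<lambda>k. integral {0..T} (f k)) has_sum J) K"
    unfolding has_sum_def
    by (intro Lim_transform_eventually[OF IJ(3)] eventually_finite_subsets_at_top_weakI) auto
  then have "((\<lambda>k. c *\<^sub>R (integral {0..T} (g k) *\<^sub>C H k)) has_sum c *\<^sub>R J) K"
    unfolding int by (rule has_sum_bounded_linear[OF bounded_linear_scaleR_right])
  then show ?thesis
    using integral_unique[OF IJ(2)] by (simp add: scaleR_left g_def[abs_def])
qed

text \<open>The index \<open>k0\<close> is the mode that the average leaves unchanged; the multipliers \<open>d k\<close> of the other
  modes are small, up to a loss \<open>W k\<close> that the coefficients can absorb.\<close>

lemma averaging_error_bound: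
  fixes H :: "'k \<Rightarrow> 'b :: complex_banach_algebra"
  assumes "((\<lambda>k. d k *\<^sub>C H k) has_sum S) K" and "k0 \<in> K" "d k0 = 1"
    and d: "\<And>k. k \<in> K \<Longrightarrow> k \<noteq> k0 \<Longrightarrow> cmod (d k) \<le> c * W k"
    and W: "\<And>k. k \<in> K \<Longrightarrow> W k \<ge> 0" "(\<lambda>k. W k * norm (H k)) summable_on K" and "c \<ge> 0"
  shows "norm (S - H k0) \<le> c * (\<Sum>\<^sub>\<infinity>k\<in>K. W k * norm (H k))"
proof (rule norm_infsum_le)
  have "((\<lambda>k. d k *\<^sub>C H k) has_sum d k0 *\<^sub>C H k0) {k0}"
    by (rule has_sum_finiteI) auto
  then have "((\<lambda>k. d k *\<^sub>C H k) has_sum S - H k0) (K - {k0})"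
    using has_sum_Diff[OF assms(1)] assms(2,3) by (simp add: scaleC_one)
  then show "((\<lambda>k. if k = k0 then 0 else d k *\<^sub>C H k) has_sum S - H k0) K"
    by (rule has_sum_cong_neutral[THEN iffD1, rotated -1]) auto
  show "((\<lambda>k. c * (W k * norm (H k))) has_sum c * (\<Sum>\<^sub>\<infinity>k\<in>K. W k * norm (H k))) K"
    by (rule has_sum_cmult_right[OF has_sum_infsum[OF W(2)]])
  fix k assume k: "k \<in> K"
  show "norm (if k = k0 then 0 else d k *\<^sub>C H k) \<le> c * (W k * norm (H k))"
    using d[OF k] W(1)[OF k] \<open>c \<ge> 0\<close> mult_right_mono[of "cmod (d k)" "c * W k" "norm (H k)"]
    by (cases "k = k0") (simp_all add: norm_scaleC mult_ac)
qed

section \<open>Convergence rate of the weighted averages\<close>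

theorem theorem3p1:
  fixes l m :: nat
    and \<Delta> :: "real \<Rightarrow> real"
    and \<Delta>' :: "nat \<Rightarrow> real \<Rightarrow> real"
    and F :: "nat \<Rightarrow> real ^ 'd \<Rightarrow> 'b :: complex_banach_algebra"
    and \<rho> :: "nat \<Rightarrow> real ^ 'd"
  assumes "l \<ge> 1" and "m \<ge> 2"
    and "approximation_function \<Delta>"
    and "\<And>j. j \<in> {1..l} \<Longrightarrow> approximation_function (\<Delta>' j)"
    and "\<And>j. j \<in> {1..l} \<Longrightarrow> F j \<in> fourier_space (\<Delta>' j)"
    and "\<And>j. j \<in> {1..l} \<Longrightarrow> \<rho> j \<in> torus"
    and "(\<lambda>k :: nat \<Rightarrow> int ^ 'd. \<Delta> (\<Sum>j=1..l. l1norm (k j)) ^ m / (\<Prod>j=1..l. \<Delta>' j (l1norm (k j))))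
           summable_on (\<Pi>\<^sub>E j\<in>{1..l}. UNIV - {0})"
  shows "(joint_nonresonant_discrete \<Delta> l \<rho> \<longrightarrow>
           (\<exists>C. \<forall>\<^sub>F N in sequentially. \<forall>\<theta>\<in>torus.
              norm (DMW l \<rho> F N \<theta> - ordered_prod (\<lambda>j. integral torus (F j)) l) \<le> C * (1 / real N ^ m)))
       \<and> (joint_nonresonant_continuous \<Delta> l \<rho> \<longrightarrow>
           (\<exists>C. \<forall>\<^sub>F T in at_top. \<forall>\<theta>\<in>torus.
              norm (CMW l \<rho> F T \<theta> - ordered_prod (\<lambda>j. integral torus (F j)) l) \<le> C * (1 / T ^ m)))"
proof -
  define K where "K = (\<Pi>\<^sub>E j\<in>{1..l}. UNIV :: (int ^ 'd) set)"
  define k0 :: "nat \<Rightarrow> int ^ 'd" where "k0 = (\<lambda>j\<in>{1..l}. 0)"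
  define \<phi> where "\<phi> k = (\<Sum>j=1..l. idot (k j) (\<rho> j))" for k
  define R where "R k = (\<Sum>j=1..l. l1norm (nonzero_block (k j)))" for k :: "nat \<Rightarrow> int ^ 'd"
  define G where "G k = ordered_prod (\<lambda>j. fourier_coeff (F j) (k j)) l" for k
  define H where "H \<theta> k = cis (2 * pi * (\<Sum>j=1..l. idot (k j) \<theta>)) *\<^sub>C G k" for \<theta> k
  define P where "P \<theta> s = ordered_prod (\<lambda>j. F j (rot (\<rho> j) s \<theta>)) l" for \<theta> s
  define Z where "Z = (\<Sum>\<^sub>\<infinity>k\<in>K. \<Delta> (R k) ^ m * norm (G k))"
  note D = approximation_function_ge_1[OF assms(3)]
  have R: "1 \<le> R k" "(\<Sum>j=1..l. l1norm (k j)) \<le> R k" for k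
  proof -
    have "l1norm (nonzero_block (k 1)) \<le> R k"
      unfolding R_def using assms(1) by (intro member_le_sum) (auto simp: l1norm_nonneg)
    then show "1 \<le> R k" using l1norm_nonzero_block(2)[of "k 1"] by linarith
    show "(\<Sum>j=1..l. l1norm (k j)) \<le> R k"
      unfolding R_def by (intro sum_mono l1norm_nonzero_block)
  qed
  have weighted: "(\<lambda>k. \<Delta> (R k) ^ m * norm (G k)) summable_on K"
    unfolding R_def G_def K_def using assms(4,5)
    by (intro summable_weighted_coefficients[OF assms(1,3) _ _ assms(7)]) auto
  have norm_H: "norm (H \<theta> k) = norm (G k)" for \<theta> k
    by (simp add: H_def norm_scaleC)
  have absH: "(\<lambda>k. norm (H \<theta> k)) summable_on K" for \<theta>
  proof (rule summable_on_comparison_test[OF weighted])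
    fix k
    have "1 \<le> \<Delta> (R k) ^ m" using D[OF R(1)] by (rule one_le_power)
    then have "1 * norm (G k) \<le> \<Delta> (R k) ^ m * norm (G k)"
      by (rule mult_right_mono) simp
    then show "norm (H \<theta> k) \<le> \<Delta> (R k) ^ m * norm (G k)" by (simp add: norm_H)
  qed simp
  have coeff: "(\<lambda>k. norm (fourier_coeff (F j) k)) summable_on UNIV" if j: "j \<in> {1..l}" for j
  proof -
    obtain B where B: "\<And>k. norm (fourier_coeff (F j) k) \<le> B / \<Delta>' j (l1norm (nonzero_block k))"
      using fourier_coeff_bound[OF assms(5)[OF j] assms(4)[OF j]] by metis
    have "(\<lambda>k :: int ^ 'd. B * (1 / \<Delta>' j (l1norm (nonzero_block k)))) summable_on UNIV"
      by (intro summable_on_cmult_right summable_single_block[OF assms(3) _ assms(7) j] assms(4))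
    then show ?thesis
      by (rule summable_on_comparison_test) (use B in auto)
  qed
  have expansion: "((\<lambda>k. cis (2 * pi * (s * \<phi> k)) *\<^sub>C H \<theta> k) has_sum P \<theta> s) K" for \<theta> s
    unfolding H_def \<phi>_def G_def P_def K_def
    by (rule product_along_orbit_has_sum[OF assms(1) assms(5) coeff]) auto
  \<comment> \<open>The zero multi-index has frequency 0; its coefficient is the product of the space averages.\<close>
  have k0: "k0 \<in> K" "\<phi> k0 = 0"
    by (auto simp: k0_def K_def \<phi>_def idot_def)
  have "cis (- (2 * pi * idot 0 \<theta>)) *\<^sub>C F j \<theta> = F j \<theta>" for j \<theta>
    by (simp add: idot_def scaleC_one)
  then have G0: "G k0 = ordered_prod (\<lambda>j. integral torus (F j)) l"
    unfolding G_def by (intro ordered_prod_cong) (simp add: k0_def fourier_coeff_def)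
  have H0: "H \<theta> k0 = ordered_prod (\<lambda>j. integral torus (F j)) l" for \<theta>
    unfolding G0[symmetric] by (simp add: H_def k0_def idot_def scaleC_one)
  have nonzero: "\<exists>j\<in>{1..l}. k j \<noteq> 0" if "k \<in> K" "k \<noteq> k0" for k
  proof (rule ccontr)
    assume "\<not> ?thesis"
    then have "k = k0"
      using that(1) by (intro ext) (auto simp: K_def k0_def PiE_def extensional_def)
    then show False using that(2) by simp
  qed
  \<comment> \<open>The weighted sum is controlled only with \<open>R k\<close> in place of the norm of \<open>k\<close>, and monotonicity of
     \<open>\<Delta>\<close> turns the nonresonance condition into a weaker one in terms of \<open>R k\<close>.\<close>
  have denominator: "\<alpha> / \<Delta> (R k) \<le> \<alpha> / \<Delta> (\<Sum>j=1..l. l1norm (k j))"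
    if "\<alpha> > 0" and k: "k \<in> K" "k \<noteq> k0" for k \<alpha>
  proof -
    obtain i where i: "i \<in> {1..l}" "k i \<noteq> 0" using nonzero[OF k] by blast
    have "l1norm (k i) \<le> (\<Sum>j=1..l. l1norm (k j))"
      using i by (intro member_le_sum) (auto simp: l1norm_nonneg)
    then have ge1: "1 \<le> (\<Sum>j=1..l. l1norm (k j))"
      using l1norm_ge_1[OF i(2)] by linarith
    show ?thesis
      using approximation_function_mono[OF assms(3) ge1 R(2)] D[OF ge1] \<open>\<alpha> > 0\<close>
      by (intro divide_left_mono) auto
  qed
  have power: "C / ((\<alpha> / \<Delta> (R k)) ^ m * X ^ m) = C / (\<alpha> ^ m * X ^ m) * \<Delta> (R k) ^ m" for C \<alpha> X k
    by (simp add: power_divide)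
  have average: "norm (S - ordered_prod (\<lambda>j. integral torus (F j)) l) \<le> C * Z / \<alpha> ^ m * (1 / X ^ m)"
    if S: "((\<lambda>k. d k *\<^sub>C H \<theta> k) has_sum S) K" "d k0 = 1"
      and d: "\<And>k. k \<in> K \<Longrightarrow> k \<noteq> k0 \<Longrightarrow> cmod (d k) \<le> C / ((\<alpha> / \<Delta> (R k)) ^ m * X ^ m)"
      and pos: "C \<ge> 0" "\<alpha> > 0" "X > 0" for d S \<theta> C \<alpha> X
  proof -
    have "norm (S - H \<theta> k0) \<le> C / (\<alpha> ^ m * X ^ m) * (\<Sum>\<^sub>\<infinity>k\<in>K. \<Delta> (R k) ^ m * norm (H \<theta> k))"
    proof (rule averaging_error_bound[where d = d and ?k0.0 = k0, OF S(1) k0(1) S(2)])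
      show "cmod (d k) \<le> C / (\<alpha> ^ m * X ^ m) * \<Delta> (R k) ^ m" if "k \<in> K" "k \<noteq> k0" for k
        using d[OF that] unfolding power .
      show "0 \<le> \<Delta> (R k) ^ m" for k
        using D[OF R(1)[of k]] by simp
    qed (use weighted pos in \<open>simp_all add: norm_H\<close>)
    then show ?thesis
      by (simp add: H0 norm_H Z_def mult_ac)
  qed
  show ?thesis
  proof (intro conjI impI)
    assume "joint_nonresonant_discrete \<Delta> l \<rho>"
    then obtain \<alpha> where \<alpha>: "\<alpha> > 0" "\<And>k n. \<exists>j\<in>{1..l}. k j \<noteq> 0 \<Longrightarrow>
        \<alpha> / \<Delta> (\<Sum>j=1..l. l1norm (k j)) \<le> \<bar>\<phi> k - real_of_int n\<bar>"
      unfolding joint_nonresonant_discrete_def \<phi>_def by (elim exE conjE) simp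
    obtain C where "C \<ge> 0" and C: "\<forall>N\<ge>4. \<forall>x \<delta>. \<delta> > 0 \<longrightarrow> (\<forall>n :: int. \<delta> \<le> \<bar>x - of_int n\<bar>) \<longrightarrow>
        cmod ((1 / (\<Sum>n<N. weight (real n / real N))) *\<^sub>R
          (\<Sum>n<N. weight (real n / real N) *\<^sub>R cis (2 * pi * (real n * x))))
          \<le> C / (\<delta> ^ m * real N ^ m)"
      using weighted_sum_bound[of m] by (elim exE conjE)
    obtain c where c: "c > 0" "\<And>N. N \<ge> 4 \<Longrightarrow> (\<Sum>n<N. weight (real n / real N)) \<ge> c * real N"
      using weight_sum_lower_bound by metis
    show "\<exists>C. \<forall>\<^sub>F N in sequentially. \<forall>\<theta>\<in>torus. norm (DMW l \<rho> F N \<theta> -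
        ordered_prod (\<lambda>j. integral torus (F j)) l) \<le> C * (1 / real N ^ m)"
    proof (intro exI eventually_mono[OF eventually_ge_at_top[of 4]] ballI)
      fix N \<theta> assume N: "N \<ge> (4 :: nat)"
      let ?A = "\<Sum>n<N. weight (real n / real N)"
      have "c * real N > 0" using c(1) N by simp
      then have A: "?A > 0" using c(2)[OF N] by linarith
      show "norm (DMW l \<rho> F N \<theta> - ordered_prod (\<lambda>j. integral torus (F j)) l)
          \<le> C * Z / \<alpha> ^ m * (1 / real N ^ m)"
      proof (rule average)
        show "((\<lambda>k. ((1 / ?A) *\<^sub>R
            (\<Sum>n<N. weight (real n / real N) *\<^sub>R cis (2 * pi * (real n * \<phi> k)))) *\<^sub>C H \<theta> k)
            has_sum DMW l \<rho> F N \<theta>) K"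
          unfolding DMW_def P_def[symmetric] by (rule discrete_average_has_sum[OF expansion])
        show "(1 / ?A) *\<^sub>R (\<Sum>n<N. weight (real n / real N) *\<^sub>R cis (2 * pi * (real n * \<phi> k0))) = 1"
          using A by (simp add: k0 flip: scaleR_sum_left)
        fix k assume k: "k \<in> K" "k \<noteq> k0"
        have \<delta>: "\<alpha> / \<Delta> (R k) > 0" using \<alpha>(1) D[OF R(1)[of k]] by simp
        have "\<forall>n :: int. \<alpha> / \<Delta> (R k) \<le> \<bar>\<phi> k - of_int n\<bar>"
          using \<alpha>(2)[OF nonzero[OF k]] denominator[OF \<alpha>(1) k] by (meson order_trans)
        then show "cmod ((1 / ?A) *\<^sub>R
            (\<Sum>n<N. weight (real n / real N) *\<^sub>R cis (2 * pi * (real n * \<phi> k))))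
            \<le> C / ((\<alpha> / \<Delta> (R k)) ^ m * real N ^ m)"
          using C N \<delta> by blast
      qed (use \<alpha>(1) N \<open>C \<ge> 0\<close> in auto)
    qed
  next
    assume "joint_nonresonant_continuous \<Delta> l \<rho>"
    then obtain \<alpha> where \<alpha>: "\<alpha> > 0" "\<And>k. \<exists>j\<in>{1..l}. k j \<noteq> 0 \<Longrightarrow>
        \<alpha> / \<Delta> (\<Sum>j=1..l. l1norm (k j)) \<le> \<bar>\<phi> k\<bar>"
      unfolding joint_nonresonant_continuous_def \<phi>_def by (elim exE conjE) simp
    obtain C where "C \<ge> 0" and C: "\<forall>T>0. \<forall>x \<delta>. \<delta> > 0 \<longrightarrow> \<delta> \<le> \<bar>x\<bar> \<longrightarrow>
        cmod ((1 / T) *\<^sub>R integral {0..T} (\<lambda>s. weight (s / T) *\<^sub>R cis (2 * pi * (s * x))))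
          \<le> C / (\<delta> ^ m * T ^ m)"
      using weighted_integral_bound[of m] by (elim exE conjE)
    show "\<exists>C. \<forall>\<^sub>F T in at_top. \<forall>\<theta>\<in>torus. norm (CMW l \<rho> F T \<theta> -
        ordered_prod (\<lambda>j. integral torus (F j)) l) \<le> C * (1 / T ^ m)"
    proof (intro exI eventually_mono[OF eventually_gt_at_top[of 0]] ballI)
      fix T :: real and \<theta> assume T: "T > 0"
      show "norm (CMW l \<rho> F T \<theta> - ordered_prod (\<lambda>j. integral torus (F j)) l)
          \<le> C * Z / \<alpha> ^ m * (1 / T ^ m)"
      proof (rule average)
        show "((\<lambda>k. ((1 / T) *\<^sub>R
            integral {0..T} (\<lambda>s. weight (s / T) *\<^sub>R cis (2 * pi * (s * \<phi> k)))) *\<^sub>C H \<theta> k)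
            has_sum CMW l \<rho> F T \<theta>) K"
          unfolding CMW_def P_def[symmetric]
          by (rule continuous_average_has_sum[OF expansion absH continuous_on_scaled_weight])
        have "integral {0..T} (\<lambda>s. weight (s / T) *\<^sub>R (1 :: complex)) =
            integral {0..T} (\<lambda>s. weight (s / T)) *\<^sub>R 1"
          using integral_linear[OF integrable_continuous_real[OF continuous_on_scaled_weight]
              bounded_linear_scaleR_left[of "1 :: complex"], of 0 T T] by (simp add: o_def)
        then show "(1 / T) *\<^sub>R integral {0..T} (\<lambda>s. weight (s / T) *\<^sub>R cis (2 * pi * (s * \<phi> k0))) = 1"
          using scaled_weight_integral[OF T] by (simp add: k0)
        fix k assume k: "k \<in> K" "k \<noteq> k0"
        have \<delta>: "\<alpha> / \<Delta> (R k) > 0" using \<alpha>(1) D[OF R(1)[of k]] by simp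
        have "\<alpha> / \<Delta> (R k) \<le> \<bar>\<phi> k\<bar>"
          using \<alpha>(2)[OF nonzero[OF k]] denominator[OF \<alpha>(1) k] by (rule order_trans[rotated])
        then show "cmod ((1 / T) *\<^sub>R
            integral {0..T} (\<lambda>s. weight (s / T) *\<^sub>R cis (2 * pi * (s * \<phi> k))))
            \<le> C / ((\<alpha> / \<Delta> (R k)) ^ m * T ^ m)"
          using C T \<delta> by blast
      qed (use \<alpha>(1) T \<open>C \<ge> 0\<close> in auto)
    qed
  qed
qed

end
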